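(* Let $e_1,e_2,e_3$ be the standard basis of $\mathbb{R}^3$ and set $$K_1=\operatorname{conv}\bigl(B_2^3\cup\{-3e_1,3e_1\}\bigr),\qquad K_2=\operatorname{conv}\bigl(B_2^3\cup\{-3e_2,3e_2\}\bigr).$$ Then $\mathcal{Q}_3(K_1,K_2)<1$, where $$\mathcal{Q}_3(B,C)=\frac{\left(\dfrac{|\partial B|_2}{|B|}+\dfrac{|\partial C|_2}{|C|}\right)^3|B|\,|C|}{27\,|B_2^3|\,|B+C|}.$$ Thus, for every sufficiently large $t$, the pair $B=tK_1$, $C=tK_2$ violates the inequality $$(|B|\,|C|)^{1/3}+(|B_2^3|\,|B_2^3+B+C|)^{1/3}\leq|B_2^3+B|^{1/3}\,|B_2^3+C|^{1/3}.$$
   Context: $B_2^3$ is the closed Euclidean unit ball of $\mathbb{R}^3$, $|K|$ is Lebesgue measure, $+$ is the Minkowski sum, and $|\partial K|_2$ is the surface area of a full-dimensional convex body $K\subset\mathbb{R}^3$, i.e. $|\partial K|_2=3V(K,K,B_2^3)$ with $V$ the mixed volume. *)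

theory Defs
  imports "HOL-Analysis.Analysis"
begin

abbreviation vol :: "(real^3) set \<Rightarrow> real" where
  "vol \<equiv> measure lebesgue"

abbreviation unit_ball :: "(real^3) set" where
  "unit_ball \<equiv> cball 0 1"

(* Minkowski's expansion: the volume of a nonnegative Minkowski combination of the bodies K i is
   the homogeneous cubic form with symmetric coefficient array v. The sum over i on the left is
   the Minkowski sum of sets (HOL-Library.Set_Algebras). *)
definition mixed_volume_coeffs ::
    "('i::finite \<Rightarrow> (real^3) set) \<Rightarrow> ('i \<Rightarrow> 'i \<Rightarrow> 'i \<Rightarrow> real) \<Rightarrow> bool" where
  "mixed_volume_coeffs K v \<longleftrightarrow>
     (\<forall>i j k. v i j k = v j i k \<and> v i j k = v i k j) \<and>
     (\<forall>t. (\<forall>i. 0 \<le> t i) \<longrightarrow>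
        vol (\<Sum>i\<in>UNIV. (*\<^sub>R) (t i) ` K i) =
          (\<Sum>i\<in>UNIV. \<Sum>j\<in>UNIV. \<Sum>k\<in>UNIV. t i * t j * t k * v i j k))"

(* The array of the triple (K, L, M) is unique when it exists, since a polynomial is determined
   by its values on the nonnegative orthant; it exists for convex bodies by Minkowski's theorem. *)
definition mixed_volume :: "(real^3) set \<Rightarrow> (real^3) set \<Rightarrow> (real^3) set \<Rightarrow> real" where
  "mixed_volume K L M =
     (THE c. \<exists>v. mixed_volume_coeffs (\<lambda>i::3. if i = 1 then K else if i = 2 then L else M) v
        \<and> c = v 1 2 3)"

definition surface_area :: "(real^3) set \<Rightarrow> real" where
  "surface_area K = 3 * mixed_volume K K unit_ball"

definition Q3 :: "(real^3) set \<Rightarrow> (real^3) set \<Rightarrow> real" where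
  "Q3 B C =
     (surface_area B / vol B + surface_area C / vol C) ^ 3 * vol B * vol C /
     (27 * vol unit_ball * vol (B + C))"

end

theory Submission
  imports Defs
begin

text \<open>
  At almost every boundary point the tangent plane of a spindle \<open>K\<close> also touches the unit ball, so \<open>3V(K,K,B) = 3|K|\<close>. This appears here as the Steiner polynomial
  \<open>|sK + rB| = |K| (s\<^sup>3 + 3s\<^sup>2r + 3sr\<^sup>2) + |B| r\<^sup>3\<close> with \<open>|K| = 20 pi / 9\<close>, obtained by integrating
  the squared meridian of a solid of revolution. Hence \<open>Q\<^sub>3 < 1\<close> amounts to
  \<open>|K\<^sub>1 + K\<^sub>2| > 800 pi / 27 = 93.08...\<close>; the true volume is \<open>94.7...\<close>, and a polytope inscribed in
  \<open>K\<^sub>1 + K\<^sub>2\<close>, cut into tetrahedra with apex at the origin, already has volume \<open>93.33...\<close>.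
  For the second claim the leading terms \<open>t\<^sup>2\<close> cancel and the coefficients of \<open>t\<close> are
  compared by the same inequality.
\<close>

section \<open>Solids of revolution\<close>

lemma borel_measurable_vector3:
  "(\<lambda>(x, y, z). vector [x, y, z] :: real^3)
    \<in> borel_measurable (borel :: (real \<times> real \<times> real) measure)"
proof -
  have "(\<lambda>(x, y, z). vector [x, y, z] :: real^3) = (\<lambda>p. fst p *\<^sub>R axis 1 1
    + fst (snd p) *\<^sub>R axis 2 1 + snd (snd p) *\<^sub>R axis 3 1)"
    by (auto simp: fun_eq_iff vec_eq_iff forall_3 axis_def)
  also have "\<dots> \<in> borel_measurable borel"
    by (intro borel_measurable_continuous_onI continuous_intros)
  finally show ?thesis .
qed

lemma emeasure_lborel_Times:
  fixes A :: "'a::euclidean_space set" and B :: "'b::euclidean_space set"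
  assumes "A \<in> sets borel" "B \<in> sets borel"
  shows "emeasure lborel (A \<times> B) = emeasure lborel A * emeasure lborel B"
proof -
  have "emeasure (lborel \<Otimes>\<^sub>M lborel) (A \<times> B) = emeasure lborel A * emeasure lborel B"
    using assms by (intro lborel.emeasure_pair_measure_Times) simp_all
  then show ?thesis unfolding lborel_prod .
qed

lemma emeasure_lborel_Times3:
  fixes a b c a' b' c' :: real
  assumes "a \<le> a'" "b \<le> b'" "c \<le> c'"
  shows "emeasure lborel ({a<..<a'} \<times> {b<..<b'} \<times> {c<..<c'}) =
    ennreal ((a' - a) * (b' - b) * (c' - c))"
proof -
  have "{b<..<b'} \<times> {c<..<c'} \<in> sets borel"
    by (simp add: borel_Times)
  then show ?thesis
    using assms by (simp add: emeasure_lborel_Times ennreal_mult mult.assoc)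
qed

lemma prod_Basis_vec3: "(\<Prod>b\<in>Basis. (x::real^3) \<bullet> b) = x$1 * x$2 * x$3"
proof -
  have "(Basis :: (real^3) set) = (\<lambda>i. axis i 1) ` UNIV"
    by (auto simp: Basis_vec_def)
  moreover have "inj (\<lambda>i::3. axis i (1::real))"
    by (auto simp: inj_on_def axis_eq_axis)
  ultimately have "(\<Prod>b\<in>Basis. x \<bullet> b) = (\<Prod>i\<in>UNIV. x \<bullet> axis i 1)"
    using prod.reindex[of "\<lambda>i::3. axis i (1::real)" UNIV "\<lambda>b. x \<bullet> b"] by (simp add: o_def)
  then show ?thesis unfolding UNIV_3 by (simp add: inner_axis mult.assoc)
qed

text \<open>Agreement on boxes determines Lebesgue measure. The iterated product on the right is
  what Fubini slices along the first coordinate.\<close>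

lemma lborel_real3:
  "(lborel :: (real^3) measure) =
     distr (lborel :: (real \<times> real \<times> real) measure) borel (\<lambda>(x, y, z). vector [x, y, z])"
proof (rule lborel_eqI)
  let ?f = "\<lambda>(x, y, z). vector [x, y, z] :: real^3"
  have meas: "?f \<in> lborel \<rightarrow>\<^sub>M borel"
    using borel_measurable_vector3 by simp
  fix l u :: "real^3"
  assume le: "\<And>b. b \<in> Basis \<Longrightarrow> l \<bullet> b \<le> u \<bullet> b"
  have vec_le: "l $ i \<le> u $ i" for i
    using le[of "axis i 1"] by (simp add: inner_axis)
  have vim: "?f -` box l u = {l$1<..<u$1} \<times> {l$2<..<u$2} \<times> {l$3<..<u$3}"
    by (auto simp: mem_box_cart forall_3)
  have "emeasure (distr lborel borel ?f) (box l u) =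
      emeasure lborel ({l$1<..<u$1} \<times> {l$2<..<u$2} \<times> {l$3<..<u$3})"
    using meas by (simp add: emeasure_distr vim)
  also have "\<dots> = (u$1 - l$1) * (u$2 - l$2) * (u$3 - l$3)"
    by (intro emeasure_lborel_Times3 vec_le)
  also have "(u$1 - l$1) * (u$2 - l$2) * (u$3 - l$3) = (\<Prod>b\<in>Basis. (u - l) \<bullet> b)"
    by (simp only: prod_Basis_vec3 vector_minus_component)
  finally show "emeasure (distr lborel borel ?f) (box l u) = (\<Prod>b\<in>Basis. (u - l) \<bullet> b)" .
qed simp

text \<open>Since \<open>f\<close> is the squared radius, the slice at \<open>x\<close> is a disc of
  area \<open>pi * f x\<close>; Fubini and the fundamental theorem of calculus give the rest. No
  square root enters the integral.\<close>

lemma vol_solid_of_revolution: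
  fixes f F :: "real \<Rightarrow> real"
  assumes ab: "a \<le> b"
    and f: "f \<in> borel_measurable borel" "\<And>x. a \<le> x \<Longrightarrow> x \<le> b \<Longrightarrow> 0 \<le> f x"
    and F: "\<And>x. a \<le> x \<Longrightarrow> x \<le> b \<Longrightarrow> (F has_real_derivative f x) (at x)"
  defines "S \<equiv> {v :: real^3. a \<le> v$1 \<and> v$1 \<le> b \<and> (v$2)\<^sup>2 + (v$3)\<^sup>2 \<le> f (v$1)}"
  shows "S \<in> lmeasurable" and "vol S = pi * (F b - F a)"
proof -
  note f(1)[measurable]
  let ?f = "\<lambda>(x, y, z). vector [x, y, z] :: real^3"
  let ?T = "{(x, y, z). a \<le> x \<and> x \<le> b \<and> y\<^sup>2 + z\<^sup>2 \<le> f x}"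
  have comp[measurable]: "(\<lambda>v :: real^3. v $ i) \<in> borel_measurable borel" for i
    by (intro borel_measurable_continuous_onI continuous_intros)
  have S: "S \<in> sets borel"
    unfolding S_def by measurable
  have meas: "?f \<in> lborel \<rightarrow>\<^sub>M borel"
    using borel_measurable_vector3 by simp
  have vim: "?f -` S = ?T"
    by (auto simp: S_def)
  have T: "?T \<in> sets (lborel \<Otimes>\<^sub>M lborel)"
    using measurable_sets[OF meas S] unfolding vim lborel_prod by simp
  have slice: "emeasure lborel (Pair x -` ?T) = ennreal (pi * f x) * indicator {a..b} x" for x
  proof (cases "x \<in> {a..b}")
    case True
    then have "Pair x -` ?T = cball 0 (sqrt (f x))"
      using f(2)[of x] by (auto simp: dist_prod_def dist_norm norm_prod_def)
    then show ?thesis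
      using True f(2)[of x] by (simp add: emeasure_cball unit_ball_vol_2)
  qed auto
  have "emeasure lborel S = emeasure (lborel \<Otimes>\<^sub>M lborel) ?T"
    using meas S by (subst lborel_real3, subst emeasure_distr) (simp_all add: vim lborel_prod)
  also have "\<dots> = (\<integral>\<^sup>+x. ennreal (pi * f x) * indicator {a..b} x \<partial>lborel)"
    by (simp only: lborel.emeasure_pair_measure_alt[OF T] slice)
  also have "\<dots> = ennreal (pi * F b - pi * F a)"
    using ab f F by (intro nn_integral_FTC_Icc) (auto intro!: derivative_eq_intros)
  finally have em: "emeasure lborel S = ennreal (pi * (F b - F a))"
    by (simp add: right_diff_distrib)
  \<comment> \<open>\<open>ennreal\<close> truncates negative numbers to zero, so the sign is
    settled before the real volume is read off.\<close>
  have "F a \<le> F b"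
  proof (rule DERIV_nonneg_imp_nondecreasing[OF ab])
    show "\<exists>y. (F has_real_derivative y) (at x) \<and> 0 \<le> y" if "a \<le> x" "x \<le> b" for x
      using that F f(2) by blast
  qed
  then show "vol S = pi * (F b - F a)"
    using em S by (simp add: measure_def)
  show "S \<in> lmeasurable"
    using em S by (simp add: fmeasurable_def)
qed

section \<open>Spindles as unions of balls\<close>

lemma norm_vec3_sq: "(norm (v :: real^3))\<^sup>2 = (v$1)\<^sup>2 + (v$2)\<^sup>2 + (v$3)\<^sup>2"
  by (simp add: norm_vec_def L2_set_def sum_3)

text \<open>A displacement from \<open>a + b\<close> is shared between the two balls in the ratio
  \<open>r : s\<close>; this leaves \<open>r + s = 0\<close> as a separate case.\<close>

lemma cball_plus_cball:
  fixes a b :: "'a::real_normed_vector"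
  assumes "0 \<le> r" "0 \<le> s"
  shows "cball a r + cball b s = cball (a + b) (r + s)"
proof (intro equalityI subsetI)
  fix x assume "x \<in> cball a r + cball b s"
  then show "x \<in> cball (a + b) (r + s)"
    by (force elim!: set_plus_elim intro: dist_triangle_add_half
        order_trans[OF dist_triangle_add])
next
  fix x assume x: "x \<in> cball (a + b) (r + s)"
  show "x \<in> cball a r + cball b s"
  proof (cases "r + s = 0")
    case True
    then have "r = 0" "s = 0" using assms by auto
    then show ?thesis using x by (auto intro: set_plus_intro)
  next
    case False
    then have pos: "r + s > 0" using assms by auto
    define d where "d = x - (a + b)"
    have d: "norm d \<le> r + s" using x by (simp add: d_def dist_norm norm_minus_commute)
    have eq: "x = (a + (r / (r + s)) *\<^sub>R d) + (b + (s / (r + s)) *\<^sub>R d)"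
    proof -
      have "(r / (r + s)) *\<^sub>R d + (s / (r + s)) *\<^sub>R d = d"
        using False by (simp flip: scaleR_add_left add_divide_distrib)
      then show ?thesis by (simp add: d_def algebra_simps)
    qed
    have "t / (r + s) * norm d \<le> t" if "0 \<le> t" for t
      using mult_left_mono[OF d that] pos by (simp add: field_simps)
    then show ?thesis
      using assms pos by (subst eq) (intro set_plus_intro; simp add: dist_norm)
  qed
qed

lemma convexD3:
  assumes "convex S" "x \<in> S" "y \<in> S" "z \<in> S" "0 \<le> a" "0 \<le> b" "0 \<le> c" "a + b + c = 1"
  shows "a *\<^sub>R x + b *\<^sub>R y + c *\<^sub>R z \<in> S"
proof -
  have "a *\<^sub>R x + b *\<^sub>R y + c *\<^sub>R z \<in> convex hull {x, y, z}"
    using assms by (auto simp: convex_hull_3)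
  moreover have "convex hull {x, y, z} \<subseteq> S"
    using assms by (intro hull_minimal) auto
  ultimately show ?thesis by blast
qed

text \<open>In a convex combination giving weight \<open>c\<close> to a ball point, the two tips
  contribute a translation by a multiple \<open>m\<close> of \<open>e\<close> with
  \<open>\<bar>m\<bar> \<le> 3 * (1 - c)\<close>. The union is convex because centres and radii obey
  linear constraints. In this form, dilating and adding a ball act on each member
  separately.\<close>

lemma spindle_eq:
  fixes e :: "'a::real_normed_vector"
  shows "convex hull (cball 0 1 \<union> {- 3 *\<^sub>R e, 3 *\<^sub>R e}) =
    (\<Union>c\<in>{0..1}. \<Union>m\<in>{-3 * (1 - c)..3 * (1 - c)}. cball (m *\<^sub>R e) c)" (is "?H = ?U")
proof
  show "?H \<subseteq> ?U"
  proof (rule hull_minimal)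
    have "cball 0 1 \<subseteq> ?U"
      by (rule order_trans[OF _ UN_upper[of 1]], rule order_trans[OF _ UN_upper[of 0]]) auto
    moreover have "- 3 *\<^sub>R e \<in> ?U"
      by (rule UN_I[of 0], simp, rule UN_I[of "-3"]) auto
    moreover have "3 *\<^sub>R e \<in> ?U"
      by (rule UN_I[of 0], simp, rule UN_I[of "3"]) auto
    ultimately show "cball 0 1 \<union> {- 3 *\<^sub>R e, 3 *\<^sub>R e} \<subseteq> ?U"
      by blast
    show "convex ?U"
    proof (rule convexI)
      fix x y u v :: "'a" and p q :: real
      assume xy: "x \<in> ?U" "y \<in> ?U" and pq: "0 \<le> p" "0 \<le> q" "p + q = 1"
      obtain c m where cm: "0 \<le> c" "c \<le> 1" "- 3 * (1 - c) \<le> m" "m \<le> 3 * (1 - c)"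
        "norm (x - m *\<^sub>R e) \<le> c"
        using xy(1) by (auto simp: dist_norm norm_minus_commute)
      obtain d n where dn: "0 \<le> d" "d \<le> 1" "- 3 * (1 - d) \<le> n" "n \<le> 3 * (1 - d)"
        "norm (y - n *\<^sub>R e) \<le> d"
        using xy(2) by (auto simp: dist_norm norm_minus_commute)
      have "(p *\<^sub>R x + q *\<^sub>R y) - (p * m + q * n) *\<^sub>R e = p *\<^sub>R (x - m *\<^sub>R e) + q *\<^sub>R (y - n *\<^sub>R e)"
        by (simp add: algebra_simps)
      then have "norm ((p *\<^sub>R x + q *\<^sub>R y) - (p * m + q * n) *\<^sub>R e) \<le> p * norm (x - m *\<^sub>R e)
        + q * norm (y - n *\<^sub>R e)"
        using pq norm_triangle_ineq[of "p *\<^sub>R (x - m *\<^sub>R e)" "q *\<^sub>R (y - n *\<^sub>R e)"] by simp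
      also have "\<dots> \<le> p * c + q * d"
        using cm dn pq by (intro add_mono mult_left_mono) auto
      finally have "p *\<^sub>R x + q *\<^sub>R y \<in> cball ((p * m + q * n) *\<^sub>R e) (p * c + q * d)"
        by (simp add: dist_norm norm_minus_commute)
      moreover have "p * c + q * d \<in> {0..1}"
        using cm dn pq convex_bound_le[of c 1 d p q] by auto
      moreover have "p * m + q * n \<in> {-3 * (1 - (p * c + q * d))..3 * (1 - (p * c + q * d))}"
      proof -
        have "p * m + q * n \<le> p * (3 * (1 - c)) + q * (3 * (1 - d))"
          "p * (- 3 * (1 - c)) + q * (- 3 * (1 - d)) \<le> p * m + q * n"
          using cm dn pq by (intro add_mono mult_left_mono; simp)+
        moreover have q: "q = 1 - p" using pq by simp
        ultimately show ?thesis unfolding q by (simp add: algebra_simps)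
      qed
      ultimately show "p *\<^sub>R x + q *\<^sub>R y \<in> ?U" by blast
    qed
  qed
  show "?U \<subseteq> ?H"
  proof clarify
    fix c m :: real and x
    assume c: "c \<in> {0..1}" and m: "m \<in> {-3 * (1 - c)..3 * (1 - c)}" and x: "x \<in> cball (m *\<^sub>R e) c"
    define d where "d = x - m *\<^sub>R e"
    have d: "norm d \<le> c" using x by (simp add: d_def dist_norm norm_minus_commute)
    \<comment> \<open>If \<open>c = 0\<close> then \<open>d = 0\<close>, and any point of the unit
      ball can serve as \<open>u\<close>.\<close>
    define u where "u = (if c = 0 then 0 else d /\<^sub>R c)"
    have u: "u \<in> cball 0 1" "c *\<^sub>R u = d"
      using c d by (auto simp: u_def divide_simps)
    have cv: "convex ?H" by simp
    \<comment> \<open>These weights solve \<open>?a + ?b = 1 - c\<close> and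
      \<open>3 * (?a - ?b) = m\<close>.\<close>
    let ?a = "(1 - c) / 2 + m / 6" and ?b = "(1 - c) / 2 - m / 6"
    have "?a \<ge> 0" "?b \<ge> 0" using m by (auto simp: field_simps)
    moreover have "u \<in> ?H" "3 *\<^sub>R e \<in> ?H" "- 3 *\<^sub>R e \<in> ?H"
      using u by (auto intro: hull_inc)
    ultimately have "c *\<^sub>R u + ?a *\<^sub>R (3 *\<^sub>R e) + ?b *\<^sub>R (- 3 *\<^sub>R e) \<in> ?H"
      using c by (intro convexD3[OF cv]) (auto simp: field_simps)
    moreover have "c *\<^sub>R u + ?a *\<^sub>R (3 *\<^sub>R e) + ?b *\<^sub>R (- 3 *\<^sub>R e) = x"
      by (simp add: u(2) d_def algebra_simps flip: scaleR_add_left)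
    ultimately show "x \<in> ?H" by simp
  qed
qed

section \<open>Reflections\<close>

lemma measure_split_hyperplane:
  fixes S :: "'a::euclidean_space set"
  assumes "S \<in> lmeasurable" "a \<noteq> 0"
  shows "measure lebesgue S = measure lebesgue (S \<inter> {x. 0 \<le> x \<bullet> a})
    + measure lebesgue (S \<inter> {x. x \<bullet> a \<le> 0})"
proof -
  let ?P = "S \<inter> {x. 0 \<le> x \<bullet> a}" and ?N = "S \<inter> {x. x \<bullet> a \<le> 0}"
  have cl: "closed {x. 0 \<le> x \<bullet> a}" "closed {x. x \<bullet> a \<le> 0}"
    using closed_halfspace_ge[of 0 a] closed_halfspace_le[of a 0] by (simp_all add: inner_commute)
  have m: "?P \<in> lmeasurable" "?N \<in> lmeasurable"
    using assms cl by (auto intro: fmeasurable_Int_fmeasurable)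
  have "negligible {x. a \<bullet> x = 0}"
    using assms by (intro negligible_hyperplane) auto
  then have "negligible (?P \<inter> ?N)"
    by (rule negligible_subset) (auto simp: inner_commute)
  then have "measure lebesgue (?P \<inter> ?N) = 0"
    by (rule negligible_imp_measure0)
  moreover have "?P \<union> ?N = S" by auto
  ultimately show ?thesis using measure_Un3[OF m] by simp
qed

text \<open>Reflection in the hyperplane with a normal of any length, hence the division by
  \<open>a \<bullet> a\<close>; for \<open>a = 0\<close> it is the identity.\<close>

definition reflection :: "'a::real_inner \<Rightarrow> 'a \<Rightarrow> 'a" where
  "reflection a x = x - (2 * (x \<bullet> a) / (a \<bullet> a)) *\<^sub>R a"

lemma reflection_inner: "a \<noteq> 0 \<Longrightarrow> reflection a x \<bullet> a = - (x \<bullet> a)"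
  by (simp add: reflection_def inner_diff_left)

lemma reflection_reflection: "a \<noteq> 0 \<Longrightarrow> reflection a (reflection a x) = x"
  using reflection_inner[of a x] by (simp add: reflection_def[of a "reflection a x"])
    (simp add: reflection_def)

lemma orthogonal_transformation_reflection:
  assumes "a \<noteq> 0"
  shows "orthogonal_transformation (reflection a)"
proof -
  have "linear (reflection a)"
    by (rule linearI) (simp_all add: reflection_def algebra_simps add_divide_distrib
      scaleR_add_left inner_add_left)
  moreover have "reflection a v \<bullet> reflection a w = v \<bullet> w" for v w
    using assms by (simp add: reflection_def inner_diff_left inner_diff_right inner_commute)
  ultimately show ?thesis by (simp add: orthogonal_transformation_def)
qed

text \<open>The reflection exchanges the two half-spaces and preserves Lebesgue measure, and their
  common hyperplane is null.\<close>

lemma measure_reflection_halves: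
  fixes S :: "(real^'n::{finite,wellorder}) set"
  assumes S: "S \<in> lmeasurable" and a: "a \<noteq> 0" and sym: "\<And>x. x \<in> S \<Longrightarrow> reflection a x \<in> S"
  shows "measure lebesgue S = 2 * measure lebesgue (S \<inter> {x. 0 \<le> x \<bullet> a})"
proof -
  let ?P = "S \<inter> {x. 0 \<le> x \<bullet> a}" and ?N = "S \<inter> {x. x \<bullet> a \<le> 0}"
  have "?N = reflection a ` ?P"
  proof (intro equalityI subsetI)
    fix x assume "x \<in> ?N"
    then have "reflection a x \<in> ?P" using a sym by (simp add: reflection_inner)
    then show "x \<in> reflection a ` ?P" using reflection_reflection[OF a, of x] by (metis image_eqI)
  qed (use a sym in \<open>auto simp: reflection_inner\<close>)
  moreover have "?P \<in> lmeasurable"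
    using S closed_halfspace_ge[of 0 a] by (auto simp: inner_commute intro:
      fmeasurable_Int_fmeasurable)
  ultimately have "measure lebesgue ?N = measure lebesgue ?P"
    using measure_orthogonal_image[OF orthogonal_transformation_reflection[OF a]] by metis
  then show ?thesis using measure_split_hyperplane[OF S a] by simp
qed

section \<open>The Steiner polynomial of a spindle\<close>

definition spindle :: "'a::real_normed_vector \<Rightarrow> 'a set" where
  "spindle e = convex hull (cball 0 1 \<union> {- 3 *\<^sub>R e, 3 *\<^sub>R e})"

lemma scaleR_image_cball:
  fixes a :: "'a::real_normed_vector"
  assumes "0 \<le> s" "0 \<le> r"
  shows "(*\<^sub>R) s ` cball a r = cball (s *\<^sub>R a) (s * r)"
proof (cases "s = 0")
  case True
  have "(\<lambda>x. 0 :: 'a) ` cball a r = {0}"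
    using assms by (auto intro!: image_eqI[of _ _ a])
  then show ?thesis using True by simp
qed (use assms cball_scale[of s a r] in simp)

text \<open>Minkowski addition distributes over the union of balls in \<open>spindle_eq\<close>, and
  radii of summed balls add.\<close>

lemma spindle_plus_ball:
  fixes e :: "'a::real_normed_vector"
  assumes "0 \<le> s" "0 \<le> r"
  shows "(*\<^sub>R) s ` spindle e + (*\<^sub>R) r ` cball 0 1 =
    (\<Union>c\<in>{0..1}. \<Union>m\<in>{-3 * (1 - c)..3 * (1 - c)}. cball ((s * m) *\<^sub>R e) (s * c + r))"
proof -
  have UN: "(\<Union>i\<in>I. A i) + C = (\<Union>i\<in>I. A i + C)" for I :: "real set" and A and C :: "'a set"
    by (auto simp: set_plus_def)
  have "(*\<^sub>R) s ` spindle e + (*\<^sub>R) r ` cball 0 1 =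
    (\<Union>c\<in>{0..1}. \<Union>m\<in>{-3 * (1 - c)..3 * (1 - c)}. (*\<^sub>R) s ` cball (m *\<^sub>R e) c + (*\<^sub>R) r ` cball 0 1)"
    by (simp only: spindle_def spindle_eq image_UN UN)
  also have "\<dots> = (\<Union>c\<in>{0..1}. \<Union>m\<in>{-3 * (1 - c)..3 * (1 - c)}. cball ((s * m) *\<^sub>R e) (s * c + r))"
    using assms by (intro SUP_cong refl) (simp add: scaleR_image_cball cball_plus_cball)
  finally show ?thesis .
qed

text \<open>
  The left-hand side says that a point at axial coordinate \<open>x\<close> and squared distance \<open>w\<close> from
  the axis lies in one of the balls of \<open>spindle_plus_ball\<close>. On the right, the meridian is an arc
  of the central ball of radius \<open>s + r\<close>, a tangent segment,
  and an arc of the end ball of radius \<open>r\<close>.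
\<close>
lemma meridian_profile_iff:
  fixes s r x w :: real
  assumes s: "0 \<le> s" and r: "0 \<le> r" and x: "0 \<le> x" and w: "0 \<le> w"
  shows "(\<exists>c\<in>{0..1}. \<exists>m\<in>{-3 * (1 - c)..3 * (1 - c)}. (x - s * m)\<^sup>2 + w \<le> (s * c + r)\<^sup>2) \<longleftrightarrow>
      x \<le> (s + r) / 3 \<and> w \<le> (s + r)\<^sup>2 - x\<^sup>2 \<or>
      (s + r) / 3 \<le> x \<and> x \<le> 3 * s + r / 3 \<and> w \<le> (3 * (s + r) - x)\<^sup>2 / 8 \<or>
      3 * s + r / 3 \<le> x \<and> x \<le> 3 * s + r \<and> w \<le> r\<^sup>2 - (x - 3 * s)\<^sup>2"
    (is "?L \<longleftrightarrow> ?A \<or> ?B \<or> ?C")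
proof
  assume ?L
  then obtain c m where c: "0 \<le> c" "c \<le> 1" and m: "-3 * (1 - c) \<le> m" "m \<le> 3 * (1 - c)"
    and le: "(x - s * m)\<^sup>2 + w \<le> (s * c + r)\<^sup>2" by auto
  \<comment> \<open>\<open>d\<close> is the loss of radius against the central ball: the ball has
    radius \<open>s + r - d\<close> and centre \<mu> with
    \<open>\<bar>\<mu>\<bar> \<le> 3 * d\<close>.\<close>
  define d where "d = s * (1 - c)"
  define \<mu> where "\<mu> = s * m"
  have d: "0 \<le> d" "d \<le> s" using s c by (auto simp: d_def mult_left_le)
  have \<mu>: "\<mu> \<le> 3 * d" "- 3 * d \<le> \<mu>"
    using mult_left_mono[OF m(2) s] mult_left_mono[OF m(1) s]
      by (auto simp: \<mu>_def d_def algebra_simps)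
  have le': "(x - \<mu>)\<^sup>2 + w \<le> (s + r - d)\<^sup>2" using le by (simp add: \<mu>_def d_def algebra_simps)
  consider "x \<le> (s + r) / 3" | "(s + r) / 3 \<le> x" "x \<le> 3 * s + r / 3" | "3 * s + r / 3 \<le> x"
    by linarith
  then show "?A \<or> ?B \<or> ?C"
  proof cases
    case 1
    have "(s + r)\<^sup>2 - x\<^sup>2 - w \<ge> 0"
    proof (cases "0 \<le> \<mu>")
      case True
      \<comment> \<open>With \<open>\<mu> = 3 * \<nu>\<close> the gap between the two squared
        profiles becomes a sum of squares and of products of nonnegative factors.\<close>
      define \<nu> where "\<nu> = \<mu> / 3"
      have \<nu>: "\<mu> = 3 * \<nu>" "0 \<le> \<nu>" "\<nu> \<le> d"
        using True \<mu> by (auto simp: \<nu>_def)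
      have "0 \<le> 2 * ((s + r - d) * (d - \<nu>))"
        using d \<nu> r by (intro mult_nonneg_nonneg) auto
      moreover have "0 \<le> \<nu> * (s + r - 3 * x)"
        using \<nu> 1 by (intro mult_nonneg_nonneg) auto
      moreover have "(s + r)\<^sup>2 - x\<^sup>2 - ((s + r - d)\<^sup>2 - (x - \<mu>)\<^sup>2) =
          2 * ((s + r - d) * (d - \<nu>)) + 2 * (\<nu> * (s + r - 3 * x)) + (d - \<nu>)\<^sup>2 + 8 * \<nu>\<^sup>2"
        unfolding \<nu>(1) by (simp add: power2_eq_square algebra_simps)
      ultimately show ?thesis
        using le' zero_le_power2[of "d - \<nu>"] zero_le_power2[of \<nu>] by linarith
    next
      case False
      then have "(x - \<mu>)\<^sup>2 \<ge> x\<^sup>2" "(s + r - d)\<^sup>2 \<le> (s + r)\<^sup>2"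
        using x d r by (auto intro!: power_mono)
      then show ?thesis using le' by simp
    qed
    then show ?thesis using 1 by simp
  next
    case 2
    \<comment> \<open>The tangent cone of a ball of radius \<rho> has its apex at distance
      \<open>3 * \<rho>\<close> from the centre. It dominates the ball: the difference is a square
      vanishing at the contact circle \<open>y = \<rho> / 3\<close>. Since
      \<open>\<mu> \<le> 3 * d\<close>, no apex lies beyond \<open>3 * (s + r)\<close>.\<close>
    have "w \<le> (3 * (s + r) - x)\<^sup>2 / 8"
    proof -
      let ?\<rho> = "s + r - d" and ?y = "x - \<mu>"
      have "(3 * ?\<rho> - ?y)\<^sup>2 - 8 * (?\<rho>\<^sup>2 - ?y\<^sup>2) = (?\<rho> - 3 * ?y)\<^sup>2"
        by (simp add: power2_eq_square algebra_simps)
      then have "8 * (?\<rho>\<^sup>2 - ?y\<^sup>2) \<le> (3 * ?\<rho> - ?y)\<^sup>2"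
        using zero_le_power2[of "?\<rho> - 3 * ?y"] by linarith
      moreover have "(3 * ?\<rho> - ?y)\<^sup>2 \<le> (3 * (s + r) - x)\<^sup>2"
      proof (rule power_mono)
        have "?y\<^sup>2 \<le> ?\<rho>\<^sup>2" using le' w by linarith
        then have "?y \<le> ?\<rho>" by (rule power2_le_imp_le) (use d r in simp)
        moreover have "0 \<le> ?\<rho>" using d r by simp
        ultimately show "0 \<le> 3 * ?\<rho> - ?y" by simp
      qed (use \<mu> in simp)
      ultimately show ?thesis using le' by simp
    qed
    then show ?thesis using 2 by simp
  next
    case 3
    \<comment> \<open>Coordinates are relative to the centre \<open>3 * s\<close> of the end ball. A
      ball whose radius exceeds \<open>r\<close> by \<open>?g\<close> is centred at least
      \<open>3 * ?g\<close> further in, which loses more height than it gains once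
      \<open>r \<le> 3 * ?y\<close>.\<close>
    let ?y = "x - 3 * s" and ?g = "s - d"
    have g: "0 \<le> ?g" "r - 3 * ?y \<le> 0" using d 3 by auto
    have "?y + 3 * ?g \<le> x - \<mu>" using \<mu> by auto
    then have "(?y + 3 * ?g)\<^sup>2 \<le> (x - \<mu>)\<^sup>2"
      using 3 g r by (intro power_mono) auto
    then have "w \<le> (r + ?g)\<^sup>2 - (?y + 3 * ?g)\<^sup>2" using le' by (simp add: algebra_simps)
    also have "\<dots> = r\<^sup>2 - ?y\<^sup>2 + 2 * (?g * (r - 3 * ?y)) - 8 * ?g\<^sup>2"
      by (simp add: power2_eq_square algebra_simps)
    also have "\<dots> \<le> r\<^sup>2 - ?y\<^sup>2"
      using mult_nonneg_nonpos[OF g] zero_le_power2[of ?g] by linarith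
    finally have fin: "w \<le> r\<^sup>2 - ?y\<^sup>2" .
    then have "?y\<^sup>2 \<le> r\<^sup>2" using w by linarith
    then have "?y \<le> r" using r by (rule power2_le_imp_le)
    then show ?thesis using fin 3 by simp
  qed
next
  assume "?A \<or> ?B \<or> ?C"
  then consider ?A | ?B | ?C by blast
  then show ?L
  proof cases
    case 1
    then show ?thesis by (intro bexI[of _ 1] bexI[of _ 0]) (auto simp: algebra_simps)
  next
    case 3
    then show ?thesis by (intro bexI[of _ 0] bexI[of _ 3]) (auto simp: algebra_simps)
  next
    case 2
    show ?thesis
    proof (cases "s = 0")
      \<comment> \<open>For \<open>s = 0\<close> the tangent segment shrinks to a single axial
        coordinate, and the formula for \<open>c\<close> below would divide by zero.\<close>
      case True
      with 2 have "x = r / 3" by auto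
      then show ?thesis using 2 True
        by (intro bexI[of _ 1] bexI[of _ 0]) (auto simp: power2_eq_square)
    next
      case False
      then have s: "0 < s" using s by simp
      \<comment> \<open>the ball whose contact circle with the tangent cone lies at axial coordinate \<open>x\<close>\<close>
      define \<rho> where "\<rho> = 3 / 8 * (3 * (s + r) - x)"
      define c where "c = (\<rho> - r) / s"
      have \<rho>: "r \<le> \<rho>" "\<rho> \<le> s + r" using 2 by (auto simp: \<rho>_def)
      have sc: "s * c + r = \<rho>" "s * (3 * (1 - c)) = 3 * (s + r - \<rho>)"
        using s by (simp_all add: c_def field_simps)
      have xe: "x - 3 * (s + r - \<rho>) = \<rho> / 3" unfolding \<rho>_def by argo
      have \<rho>2: "8 / 9 * \<rho>\<^sup>2 = (3 * (s + r) - x)\<^sup>2 / 8"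
        unfolding \<rho>_def power_mult_distrib by (simp add: power2_eq_square)
      have "(x - s * (3 * (1 - c)))\<^sup>2 + w \<le> (s * c + r)\<^sup>2"
        using 2 \<rho>2 unfolding sc xe power_divide by simp
      moreover have "c \<in> {0..1}"
        using \<rho> s by (auto simp: c_def field_simps)
      ultimately show ?thesis by (intro bexI[of _ c] bexI[of _ "3 * (1 - c)"]) auto
    qed
  qed
qed

section \<open>Symmetries and volume of the parallel bodies of a spindle\<close>

lemma compact_spindle: "compact (spindle e)"
  for e :: "'a::euclidean_space"
  unfolding spindle_def by (intro compact_convex_hull compact_Un) (auto intro: finite_imp_compact)

lemma compact_set_plus:
  fixes A B :: "'a::real_normed_vector set"
  assumes "compact A" "compact B"
  shows "compact (A + B)"
proof -
  have "A + B = {x + y |x y. x \<in> A \<and> y \<in> B}"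
    by (auto simp: set_plus_def)
  then show ?thesis using compact_sums[OF assms] by simp
qed

lemma orthogonal_image_spindle_plus_ball:
  fixes f :: "'a::euclidean_space \<Rightarrow> 'a"
  assumes f: "orthogonal_transformation f" and s: "0 \<le> s" and r: "0 \<le> r"
  shows "f ` ((*\<^sub>R) s ` spindle e + (*\<^sub>R) r ` cball 0 1) =
    (*\<^sub>R) s ` spindle (f e) + (*\<^sub>R) r ` cball 0 1"
  unfolding spindle_plus_ball[OF s r] image_UN image_orthogonal_transformation_cball[OF f]
    linear_cmul[OF orthogonal_transformation_linear[OF f]] ..

lemma spindle_minus: "spindle (- e) = spindle e"
  by (simp add: spindle_def insert_commute)

lemma reflection_self: "reflection e e = - e"
proof (cases "e = 0")
  case False
  then have "reflection e e = e - (1 + 1) *\<^sub>R e"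
    by (simp add: reflection_def)
  then show ?thesis
    unfolding scaleR_add_left by simp
qed (simp add: reflection_def)

lemma reflection_spindle_plus_ball:
  fixes e :: "'a::euclidean_space"
  assumes e: "e \<noteq> 0" and s: "0 \<le> s" and r: "0 \<le> r"
    and x: "x \<in> (*\<^sub>R) s ` spindle e + (*\<^sub>R) r ` cball 0 1"
  shows "reflection e x \<in> (*\<^sub>R) s ` spindle e + (*\<^sub>R) r ` cball 0 1"
  using imageI[OF x, of "reflection e"]
  unfolding orthogonal_image_spindle_plus_ball[OF orthogonal_transformation_reflection[OF e] s r]
    reflection_self spindle_minus .

lemma mem_spindle_plus_ball:
  fixes v :: "real^3"
  assumes s: "0 \<le> s" and r: "0 \<le> r" and v: "0 \<le> v$1"
  shows "v \<in> (*\<^sub>R) s ` spindle (axis 1 1) + (*\<^sub>R) r ` cball 0 1 \<longleftrightarrow>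
      v$1 \<le> (s + r) / 3 \<and> (v$2)\<^sup>2 + (v$3)\<^sup>2 \<le> (s + r)\<^sup>2 - (v$1)\<^sup>2 \<or>
      (s + r) / 3 \<le> v$1 \<and> v$1 \<le> 3 * s + r / 3 \<and> (v$2)\<^sup>2 + (v$3)\<^sup>2 \<le> (3 * (s + r) - v$1)\<^sup>2 / 8 \<or>
      3 * s + r / 3 \<le> v$1 \<and> v$1 \<le> 3 * s + r \<and> (v$2)\<^sup>2 + (v$3)\<^sup>2 \<le> r\<^sup>2 - (v$1 - 3 * s)\<^sup>2"
proof -
  have ball: "v \<in> cball (m *\<^sub>R axis 1 1) q \<longleftrightarrow> (v$1 - m)\<^sup>2 + ((v$2)\<^sup>2 + (v$3)\<^sup>2) \<le> q\<^sup>2" if "0 \<le> q"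
    for m q
  proof -
    have "v \<in> cball (m *\<^sub>R axis 1 1) q \<longleftrightarrow> (norm (v - m *\<^sub>R axis 1 1))\<^sup>2 \<le> q\<^sup>2"
      unfolding mem_cball dist_norm norm_minus_commute[of _ v]
      using that by (metis norm_ge_zero power2_le_imp_le power_mono)
    also have "(norm (v - m *\<^sub>R axis 1 1))\<^sup>2 = (v$1 - m)\<^sup>2 + ((v$2)\<^sup>2 + (v$3)\<^sup>2)"
      unfolding norm_vec3_sq by (simp add: axis_def)
    finally show ?thesis .
  qed
  have "v \<in> (*\<^sub>R) s ` spindle (axis 1 1) + (*\<^sub>R) r ` cball 0 1 \<longleftrightarrow>
      (\<exists>c\<in>{0..1}. \<exists>m\<in>{-3 * (1 - c)..3 * (1 - c)}. v \<in> cball ((s * m) *\<^sub>R axis 1 1) (s * c + r))"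
    unfolding spindle_plus_ball[OF s r] by blast
  also have "\<dots> \<longleftrightarrow> (\<exists>c\<in>{0..1}. \<exists>m\<in>{-3 * (1 - c)..3 * (1 - c)}.
      (v$1 - s * m)\<^sup>2 + ((v$2)\<^sup>2 + (v$3)\<^sup>2) \<le> (s * c + r)\<^sup>2)"
    using s r by (intro bex_cong refl ball) simp
  finally show ?thesis
    unfolding meridian_profile_iff[OF s r v sum_power2_ge_zero[of "v$2" "v$3"]] .
qed

text \<open>Reflection along the axis halves the body, and the three pieces of
  \<open>meridian_profile_iff\<close> are solids of revolution with polynomial squared
  radii.\<close>

lemma vol_spindle_plus_ball_1:
  assumes s: "0 \<le> s" and r: "0 \<le> r"
  shows "vol ((*\<^sub>R) s ` spindle (axis 1 1) + (*\<^sub>R) r ` cball 0 1) =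
    20 * pi / 9 * (s^3 + 3 * s\<^sup>2 * r + 3 * s * r\<^sup>2) + 4 * pi / 3 * r^3"
proof -
  let ?S = "(*\<^sub>R) s ` spindle (axis 1 1) + (*\<^sub>R) r ` cball 0 1 :: (real^3) set"
  let ?R = "s + r"
  define f g h :: "real \<Rightarrow> real" where "f x = ?R\<^sup>2 - x\<^sup>2"
    and "g x = (3 * ?R - x)\<^sup>2 / 8" and "h x = r\<^sup>2 - (x - 3 * s)\<^sup>2" for x
  define slab where "slab a b \<phi> = {v :: real^3. a \<le> v$1 \<and> v$1 \<le> b \<and> (v$2)\<^sup>2 + (v$3)\<^sup>2 \<le> \<phi> (v$1)}"
    for a b and \<phi> :: "real \<Rightarrow> real"
  let ?A = "slab 0 (?R / 3) f" and ?B = "slab (?R / 3) (3 * s + r / 3) g"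
    and ?C = "slab (3 * s + r / 3) (3 * s + r) h"
  have lm: "?S \<in> lmeasurable"
    by (intro lmeasurable_compact compact_set_plus compact_scaling compact_spindle compact_cball)
  have a0: "axis 1 1 \<noteq> (0 :: real^3)" by (simp add: axis_eq_0_iff)
  have symm: "reflection (axis 1 1) x \<in> ?S" if "x \<in> ?S" for x
    using that reflection_spindle_plus_ball[OF a0 s r] by blast
  have half: "?S \<inter> {x. 0 \<le> x \<bullet> axis 1 1} = ?A \<union> ?B \<union> ?C"
  proof (intro set_eqI)
    fix v :: "real^3"
    show "v \<in> ?S \<inter> {x. 0 \<le> x \<bullet> axis 1 1} \<longleftrightarrow> v \<in> ?A \<union> ?B \<union> ?C"
    proof (cases "0 \<le> v$1")
      case True
      then show ?thesis
        using s r unfolding Int_iff mem_spindle_plus_ball[OF s r True]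
        by (auto simp: slab_def f_def g_def h_def inner_axis)
    next
      case False
      then show ?thesis
        using s r by (auto simp: slab_def inner_axis)
    qed
  qed
  have f: "\<And>x. 0 \<le> x \<Longrightarrow> x \<le> ?R / 3 \<Longrightarrow> 0 \<le> f x"
    using s r unfolding f_def by (simp add: power_mono)
  have h: "0 \<le> h x" if "3 * s + r / 3 \<le> x" "x \<le> 3 * s + r" for x
    using that r unfolding h_def by (simp add: power_mono)
  have f_meas: "f \<in> borel_measurable borel" "g \<in> borel_measurable borel"
    "h \<in> borel_measurable borel"
    unfolding f_def g_def h_def by measurable
  define F G H :: "real \<Rightarrow> real" where "F x = ?R\<^sup>2 * x - x^3 / 3"
    and "G x = - ((3 * ?R - x)^3 / 24)" and "H x = r\<^sup>2 * x - (x - 3 * s)^3 / 3" for x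
  have dF: "(F has_real_derivative f x) (at x)" and dG: "(G has_real_derivative g x) (at x)"
    and dH: "(H has_real_derivative h x) (at x)" for x
    unfolding f_def g_def h_def F_def G_def H_def by (auto intro!: derivative_eq_intros)
  have le: "0 \<le> ?R / 3" "?R / 3 \<le> 3 * s + r / 3" "3 * s + r / 3 \<le> 3 * s + r"
    using s r by auto
  have g: "0 \<le> g x" for x by (simp add: g_def)
  have A: "?A \<in> lmeasurable" "vol ?A = pi * (F (?R / 3) - F 0)"
    unfolding slab_def by (rule vol_solid_of_revolution[OF le(1) f_meas(1) f dF]; assumption)+
  have B: "?B \<in> lmeasurable" "vol ?B = pi * (G (3 * s + r / 3) - G (?R / 3))"
    unfolding slab_def by (rule vol_solid_of_revolution[OF le(2) f_meas(2) g dG])+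
  have C: "?C \<in> lmeasurable" "vol ?C = pi * (H (3 * s + r) - H (3 * s + r / 3))"
    unfolding slab_def by (rule vol_solid_of_revolution[OF le(3) f_meas(3) h dH]; assumption)+
  have neg: "negligible {v :: real^3. v$1 = c}" for c
    using negligible_standard_hyperplane[of "axis 1 1 :: real^3" c]
      by (simp add: inner_axis axis_in_Basis_iff)
  have "negligible (?A \<inter> ?B)" "negligible (?A \<inter> ?C)"
    by (rule negligible_subset[OF neg[of "?R / 3"]]; use s r in \<open>auto simp: slab_def\<close>)+
  moreover have "negligible (?B \<inter> ?C)"
    by (rule negligible_subset[OF neg[of "3 * s + r / 3"]]; use s r in \<open>auto simp: slab_def\<close>)
  ultimately have "vol (?A \<union> ?B \<union> ?C) = vol ?A + vol ?B + vol ?C"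
    by (rule measure_Un3_negligible[OF A(1) B(1) C(1) _ _ _ refl])
  moreover have "vol ?S = 2 * vol (?A \<union> ?B \<union> ?C)"
    using measure_reflection_halves[OF lm a0 symm] unfolding half .
  ultimately have "vol ?S = 2 * (pi * (F (?R / 3) - F 0) + pi * (G (3 * s + r / 3) - G (?R / 3)) +
      pi * (H (3 * s + r) - H (3 * s + r / 3)))"
    by (simp only: A B C)
  also have "\<dots> = 20 * pi / 9 * (s^3 + 3 * s\<^sup>2 * r + 3 * s * r\<^sup>2) + 4 * pi / 3 * r^3"
    unfolding F_def G_def H_def by (simp add: field_simps power2_eq_square power3_eq_cube)
  finally show ?thesis .
qed

lemma orthogonal_image_spindle:
  fixes f :: "'a::euclidean_space \<Rightarrow> 'a"
  assumes "orthogonal_transformation f"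
  shows "f ` spindle e = spindle (f e)"
  using orthogonal_image_spindle_plus_ball[OF assms, of 1 0 e] by (simp add: image_constant_conv)

lemma reflection_axis_swap_right:
  "reflection (axis 1 1 - axis k 1) (axis k 1) = (axis 1 1 :: real^'n::{finite,one})"
proof (cases "k = 1")
  case False
  then show ?thesis
    by (simp add: reflection_def inner_diff_left inner_diff_right inner_axis_axis)
qed (simp add: reflection_def)

text \<open>The reflection with normal \<open>axis 1 1 - axis k 1\<close> carries axis
  \<open>k\<close> to the first one; this normal vanishes for \<open>k = 1\<close>.\<close>

lemma vol_spindle_plus_ball:
  assumes s: "0 \<le> s" and r: "0 \<le> r"
  shows "vol ((*\<^sub>R) s ` spindle (axis k 1) + (*\<^sub>R) r ` cball 0 1) =
    20 * pi / 9 * (s^3 + 3 * s\<^sup>2 * r + 3 * s * r\<^sup>2) + 4 * pi / 3 * r^3"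
proof (cases "k = 1")
  case True
  then show ?thesis using vol_spindle_plus_ball_1[OF s r] by simp
next
  case False
  then have a: "axis 1 1 - axis k 1 \<noteq> (0 :: real^3)"
    by (simp add: axis_eq_axis)
  let ?f = "reflection (axis 1 1 - axis k 1 :: real^3)"
  let ?S = "(*\<^sub>R) s ` spindle (axis k 1 :: real^3) + (*\<^sub>R) r ` cball 0 1"
  have f: "orthogonal_transformation ?f" by (rule orthogonal_transformation_reflection[OF a])
  have "?S \<in> lmeasurable"
    by (intro lmeasurable_compact compact_set_plus compact_scaling compact_spindle compact_cball)
  then have "vol (?f ` ?S) = vol ?S" by (rule measure_orthogonal_image[OF f])
  then show ?thesis
    unfolding orthogonal_image_spindle_plus_ball[OF f s r] reflection_axis_swap_right
    using vol_spindle_plus_ball_1[OF s r] by simp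
qed

section \<open>Mixed volume and surface area\<close>

text \<open>Merges the two copies of the body in the triple (K, K, ball), so that its Minkowski
  polynomial is the Steiner polynomial at \<open>s = t 1 + t 2\<close>,
  \<open>r = t 3\<close>.\<close>

lemma convex_scaleR_plus:
  fixes K :: "'a::real_vector set"
  assumes K: "convex K" and s: "0 \<le> s" and t: "0 \<le> t"
  shows "(*\<^sub>R) s ` K + (*\<^sub>R) t ` K = (*\<^sub>R) (s + t) ` K"
proof (intro equalityI subsetI)
  fix x assume "x \<in> (*\<^sub>R) s ` K + (*\<^sub>R) t ` K"
  then obtain y z where yz: "y \<in> K" "z \<in> K" and x: "x = s *\<^sub>R y + t *\<^sub>R z"
    by (auto elim!: set_plus_elim)
  show "x \<in> (*\<^sub>R) (s + t) ` K"
  proof (cases "s + t = 0")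
    case True
    then have "s = 0" "t = 0" using s t by auto
    then show ?thesis using yz x by auto
  next
    case False
    then have "(s / (s + t)) *\<^sub>R y + (t / (s + t)) *\<^sub>R z \<in> K"
      using s t yz by (intro convexD[OF K]) (auto simp flip: add_divide_distrib)
    moreover have "x = (s + t) *\<^sub>R ((s / (s + t)) *\<^sub>R y + (t / (s + t)) *\<^sub>R z)"
      using False x by (simp add: scaleR_add_right)
    ultimately show ?thesis by blast
  qed
next
  fix x assume "x \<in> (*\<^sub>R) (s + t) ` K"
  then show "x \<in> (*\<^sub>R) s ` K + (*\<^sub>R) t ` K"
    by (auto simp: scaleR_add_left)
qed

lemma convex_spindle: "convex (spindle e)"
  by (simp add: spindle_def)

lemma mixed_volume_spindle:
  "mixed_volume (spindle (axis k 1)) (spindle (axis k 1)) unit_ball = 20 * pi / 9"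
proof -
  let ?K = "spindle (axis k 1) :: (real^3) set"
  let ?T = "\<lambda>i::3. if i = 1 then ?K else if i = 2 then ?K else unit_ball"
  define \<alpha> \<beta> where "\<alpha> = 20 * pi / 9" and "\<beta> = 4 * pi / 3"
  have vol: "vol (\<Sum>i\<in>UNIV. (*\<^sub>R) (t i) ` ?T i) =
      \<alpha> * ((t 1 + t 2)^3 + 3 * (t 1 + t 2)\<^sup>2 * t 3 + 3 * (t 1 + t 2) * (t 3)\<^sup>2) + \<beta> * (t 3)^3"
    if "\<forall>i. 0 \<le> t i" for t :: "3 \<Rightarrow> real"
  proof -
    have "(\<Sum>i\<in>UNIV. (*\<^sub>R) (t i) ` ?T i) = (*\<^sub>R) (t 1) ` ?K + (*\<^sub>R) (t 2) ` ?K
      + (*\<^sub>R) (t 3) ` unit_ball"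
      by (simp add: sum_3)
    also have "\<dots> = (*\<^sub>R) (t 1 + t 2) ` ?K + (*\<^sub>R) (t 3) ` unit_ball"
      using that by (simp only: convex_scaleR_plus[OF convex_spindle])
    finally show ?thesis
      using that by (simp only: vol_spindle_plus_ball add_nonneg_nonneg \<alpha>_def \<beta>_def)
  qed
  \<comment> \<open>The form equals \<open>\<alpha> * ((t 1 + t 2 + t 3)^3 - (t 3)^3) + \<beta> * (t
    3)^3\<close>, so only the entry at (3, 3, 3) differs from \<alpha>.\<close>
  define w :: "3 \<Rightarrow> 3 \<Rightarrow> 3 \<Rightarrow> real" where "w i j k = (if i = 3 \<and> j = 3 \<and> k = 3 then \<beta> else \<alpha>)"
    for i j k
  have "mixed_volume_coeffs ?T w"
    unfolding mixed_volume_coeffs_def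
  proof (intro conjI allI impI)
    fix t :: "3 \<Rightarrow> real" assume t: "\<forall>i. 0 \<le> t i"
    show "vol (\<Sum>i\<in>UNIV. (*\<^sub>R) (t i) ` ?T i) =
        (\<Sum>i\<in>UNIV. \<Sum>j\<in>UNIV. \<Sum>k\<in>UNIV. t i * t j * t k * w i j k)"
      unfolding vol[OF t]
      by (simp add: sum_3 w_def power2_eq_square power3_eq_cube algebra_simps)
  qed (auto simp: w_def)
  moreover have unique: "v 1 2 3 = \<alpha>" if v: "mixed_volume_coeffs ?T v" for v
  proof -
    have sym: "v i j k = v j i k" "v i j k = v i k j" for i j k
      using v by (auto simp: mixed_volume_coeffs_def)
    \<comment> \<open>Sorting the indices collapses the 27 entries to ten unknowns.\<close>
    have sym': "v 2 1 1 = v 1 1 2" "v 1 2 1 = v 1 1 2" "v 3 1 1 = v 1 1 3" "v 1 3 1 = v 1 1 3"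
      "v 2 1 2 = v 1 2 2" "v 2 2 1 = v 1 2 2" "v 3 2 2 = v 2 2 3" "v 2 3 2 = v 2 2 3"
      "v 3 1 3 = v 1 3 3" "v 3 3 1 = v 1 3 3" "v 3 2 3 = v 2 3 3" "v 3 3 2 = v 2 3 3"
      "v 1 3 2 = v 1 2 3" "v 2 1 3 = v 1 2 3" "v 2 3 1 = v 1 2 3" "v 3 1 2 = v 1 2 3"
      "v 3 2 1 = v 1 2 3"
      by (simp_all add: sym)
    have eq: "\<alpha> * ((a + b)^3 + 3 * (a + b)\<^sup>2 * c + 3 * (a + b) * c\<^sup>2) + \<beta> * c^3 =
        a^3 * v 1 1 1 + b^3 * v 2 2 2 + c^3 * v 3 3 3 + 3 * (a\<^sup>2 * b * v 1 1 2 + a\<^sup>2 * c * v 1 1 3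
          + a * b\<^sup>2 * v 1 2 2 + b\<^sup>2 * c * v 2 2 3 + a * c\<^sup>2 * v 1 3 3 + b * c\<^sup>2 * v 2 3 3)
          + 6 * (a * b * c * v 1 2 3)" if "0 \<le> a" "0 \<le> b" "0 \<le> c" for a b c
    proof -
      define t where "t = (\<lambda>i::3. if i = 1 then a else if i = 2 then b else c)"
      have t: "\<forall>i. 0 \<le> t i" and [simp]: "t 1 = a" "t 2 = b" "t 3 = c"
        using that by (auto simp: t_def)
      have "vol (\<Sum>i\<in>UNIV. (*\<^sub>R) (t i) ` ?T i) =
        (\<Sum>i\<in>UNIV. \<Sum>j\<in>UNIV. \<Sum>k\<in>UNIV. t i * t j * t k * v i j k)"
        using v t unfolding mixed_volume_coeffs_def by blast
      then show ?thesis
        unfolding vol[OF t] by (simp add: sum_3 sym' power2_eq_square power3_eq_cube algebra_simps)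
    qed
    \<comment> \<open>inclusion-exclusion over the vertices of the unit cube isolates the coefficient of \<open>a b c\<close>\<close>
    show ?thesis
      using eq[of 1 1 1] eq[of 1 1 0] eq[of 1 0 1] eq[of 0 1 1] eq[of 1 0 0] eq[of 0 1 0]
        eq[of 0 0 1]
      by simp
  qed
  moreover have "w 1 2 3 = \<alpha>"
    by (simp add: w_def)
  ultimately have "(THE c. \<exists>v. mixed_volume_coeffs ?T v \<and> c = v 1 2 3) = \<alpha>"
    by (intro the_equality) (blast intro: sym, use unique in blast)
  then show ?thesis
    unfolding mixed_volume_def \<alpha>_def .
qed

lemma vol_spindle: "vol (spindle (axis k 1)) = 20 * pi / 9"
  using vol_spindle_plus_ball[of 1 0 k] by (simp add: image_constant_conv)

lemma surface_area_spindle: "surface_area (spindle (axis k 1)) = 20 * pi / 3"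
  by (simp add: surface_area_def mixed_volume_spindle)

lemma vol_unit_ball: "vol unit_ball = 4 * pi / 3"
  by (simp add: content_cball unit_ball_vol_3)

section \<open>Cones over inscribed tetrahedra\<close>

text \<open>Otherwise \<open>sin (21 / 40)\<close> would be at most 1/2, but the cubic Taylor
  polynomial less its fifth-order error bound exceeds 1/2. At 63/20 in place of pi the target
  \<open>800 * pi / 27\<close> becomes 280/3.\<close>

lemma pi_less_63_20: "pi < 63 / 20"
proof (rule ccontr)
  assume "\<not> pi < 63 / 20"
  then have "21 / 40 \<le> pi / 6" by simp
  then have "sin (21 / 40) \<le> sin (pi / 6 :: real)"
    using pi_gt_zero by (intro sin_monotone_2pi_le) (auto intro: order_trans[of _ 0])
  then have le: "sin (21 / 40) \<le> (1 / 2 :: real)" by (simp add: sin_30)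
  have "\<bar>sin (21 / 40) - (\<Sum>m<5. sin_coeff m * (21 / 40) ^ m)\<bar> \<le> inverse (fact 5) * \<bar>21 / 40\<bar> ^ 5"
    by (rule Maclaurin_sin_bound)
  moreover have "(\<Sum>m<5. sin_coeff m * (21 / 40) ^ m) = (21 / 40 - (21 / 40) ^ 3 / 6 :: real)"
    by (simp add: sin_coeff_def lessThan_nat_numeral fact_numeral power3_eq_cube)
  ultimately show False using le by (simp add: fact_numeral eval_nat_numeral abs_le_iff)
qed

text \<open>Cutting a body by such cones subdivides it without a description of its boundary; only
  the final pieces are compared with tetrahedra.\<close>

definition cone3 :: "'a::real_vector \<Rightarrow> 'a \<Rightarrow> 'a \<Rightarrow> 'a set" where
  "cone3 u v w = {a *\<^sub>R u + b *\<^sub>R v + c *\<^sub>R w |a b c. 0 \<le> a \<and> 0 \<le> b \<and> 0 \<le> c}"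

lemma cone3I: "0 \<le> a \<Longrightarrow> 0 \<le> b \<Longrightarrow> 0 \<le> c \<Longrightarrow> a *\<^sub>R u + b *\<^sub>R v + c *\<^sub>R w \<in> cone3 u v w"
  by (auto simp: cone3_def)

lemma cone3_swap: "cone3 u v w = cone3 v u w" "cone3 u v w = cone3 u w v"
proof -
  have "cone3 u v w \<subseteq> cone3 v u w" "cone3 u v w \<subseteq> cone3 u w v" for u v w :: 'a
    by (smt (verit) cone3_def mem_Collect_eq subsetI add.commute add.assoc add.left_commute)+
  then show "cone3 u v w = cone3 v u w" "cone3 u v w = cone3 u w v" by blast+
qed

lemma convex_cone3: "convex (cone3 u v w)"
proof (rule convexI)
  fix x y and p q :: real
  assume xy: "x \<in> cone3 u v w" "y \<in> cone3 u v w" and pq: "0 \<le> p" "0 \<le> q"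
  obtain a b c where x: "x = a *\<^sub>R u + b *\<^sub>R v + c *\<^sub>R w" "0 \<le> a" "0 \<le> b" "0 \<le> c"
    using xy(1) by (auto simp: cone3_def)
  obtain d e f where y: "y = d *\<^sub>R u + e *\<^sub>R v + f *\<^sub>R w" "0 \<le> d" "0 \<le> e" "0 \<le> f"
    using xy(2) by (auto simp: cone3_def)
  have "p *\<^sub>R x + q *\<^sub>R y = (p * a + q * d) *\<^sub>R u + (p * b + q * e) *\<^sub>R v + (p * c + q * f) *\<^sub>R w"
    by (simp add: x y algebra_simps)
  also have "\<dots> \<in> cone3 u v w"
    using pq x y by (intro cone3I) auto
  finally show "p *\<^sub>R x + q *\<^sub>R y \<in> cone3 u v w" .
qed

text \<open>The plane through the origin, \<open>m\<close> and \<open>w\<close> separates the two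
  subcones, so they overlap in a null set.\<close>

lemma measure_Int_cone3_split:
  fixes S :: "(real^3) set"
  assumes S: "convex S" "bounded S" and m: "m = \<alpha> *\<^sub>R u + \<beta> *\<^sub>R v" "0 < \<alpha>" "0 < \<beta>"
    and n0: "cross3 m w \<noteq> 0"
  shows "vol (S \<inter> cone3 u m w) + vol (S \<inter> cone3 m v w) \<le> vol (S \<inter> cone3 u v w)"
proof -
  let ?A = "S \<inter> cone3 u m w" and ?B = "S \<inter> cone3 m v w" and ?n = "cross3 m w"
  have lm: "S \<inter> cone3 x y z \<in> lmeasurable" for x y z
    using S by (intro measurable_convex convex_Int convex_cone3 bounded_Int) auto
  have comb: "a *\<^sub>R u + b *\<^sub>R m + c *\<^sub>R w = (a + b * \<alpha>) *\<^sub>R u + (b * \<beta>) *\<^sub>R v + c *\<^sub>R w"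
    "b *\<^sub>R m + a *\<^sub>R v + c *\<^sub>R w = (b * \<alpha>) *\<^sub>R u + (a + b * \<beta>) *\<^sub>R v + c *\<^sub>R w" for a b c
    by (simp_all add: m(1) algebra_simps)
  have sub: "?A \<union> ?B \<subseteq> S \<inter> cone3 u v w"
  proof -
    have "cone3 u m w \<subseteq> cone3 u v w"
    proof
      fix x assume "x \<in> cone3 u m w"
      then obtain a b c where "x = a *\<^sub>R u + b *\<^sub>R m + c *\<^sub>R w" "0 \<le> a" "0 \<le> b" "0 \<le> c"
        by (auto simp: cone3_def)
      then show "x \<in> cone3 u v w" using m(2,3) by (auto simp: comb intro!: cone3I)
    qed
    moreover have "cone3 m v w \<subseteq> cone3 u v w"
    proof
      fix x assume "x \<in> cone3 m v w"
      then obtain a b c where "x = b *\<^sub>R m + a *\<^sub>R v + c *\<^sub>R w" "0 \<le> a" "0 \<le> b" "0 \<le> c"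
        by (auto simp: cone3_def)
      then show "x \<in> cone3 u v w" using m(2,3) by (auto simp: comb intro!: cone3I)
    qed
    ultimately show ?thesis by blast
  qed
  have n: "m \<bullet> ?n = 0" "w \<bullet> ?n = 0"
    by (simp_all add: dot_cross_self)
  then have "\<alpha> * (u \<bullet> ?n) + \<beta> * (v \<bullet> ?n) = 0"
    by (simp add: m(1) inner_add_left)
  have "?A \<inter> ?B \<subseteq> {x. ?n \<bullet> x = 0}"
  proof
    fix x assume "x \<in> ?A \<inter> ?B"
    then have "x \<in> cone3 u m w" "x \<in> cone3 m v w" by auto
    then obtain a b c a' b' c' where x: "x = a *\<^sub>R u + b *\<^sub>R m + c *\<^sub>R w" "0 \<le> a"
      and x': "x = a' *\<^sub>R m + b' *\<^sub>R v + c' *\<^sub>R w" "0 \<le> b'"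
      unfolding cone3_def by blast
    have 1: "x \<bullet> ?n = a * (u \<bullet> ?n)" by (simp add: x(1) inner_add_left n)
    have 2: "x \<bullet> ?n = b' * (v \<bullet> ?n)" by (simp add: x'(1) inner_add_left n)
    have un: "u \<bullet> ?n = - (\<beta> / \<alpha>) * (v \<bullet> ?n)"
      using \<open>\<alpha> * (u \<bullet> ?n) + \<beta> * (v \<bullet> ?n) = 0\<close> m(2) by (simp add: field_simps)
    \<comment> \<open>The products \<open>u \<bullet> ?n\<close> and \<open>v \<bullet> ?n\<close>
      have opposite signs or vanish, so multiplying the two expressions for
      \<open>x \<bullet> ?n\<close> makes its square nonpositive.\<close>
    have "(x \<bullet> ?n)\<^sup>2 = - (a * b' * (\<beta> / \<alpha>) * (v \<bullet> ?n)\<^sup>2)"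
      unfolding power2_eq_square[of "x \<bullet> ?n"] by (subst 1, subst 2, subst un)
        (simp add: power2_eq_square)
    also have "\<dots> \<le> 0" using x(2) x'(2) m(2,3) by (simp add: mult_nonneg_nonneg)
    finally show "x \<in> {x. ?n \<bullet> x = 0}" by (simp add: inner_commute)
  qed
  then have "negligible (?A \<inter> ?B)"
    by (rule negligible_subset[rotated]) (use n0 in \<open>simp add: negligible_hyperplane\<close>)
  then have "vol (?A \<inter> ?B) = 0" by (rule negligible_imp_measure0)
  then have "vol ?A + vol ?B = vol (?A \<union> ?B)"
    using measure_Un3[OF lm lm, of u m w m v w] by simp
  also have "\<dots> \<le> vol (S \<inter> cone3 u v w)"
    using sub lm by (intro measure_mono_fmeasurable) (auto intro: fmeasurableD)
  finally show ?thesis .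
qed

text \<open>The tetrahedron with vertices 0, \<open>u\<close>, \<open>v\<close>, \<open>w\<close>
  lies in both convex sets and is a linear image of the standard simplex, of volume 1/6.\<close>

lemma det_le_measure_Int_cone3:
  fixes S :: "(real^3) set"
  assumes S: "convex S" "bounded S" "0 \<in> S" and uvw: "u \<in> S" "v \<in> S" "w \<in> S"
  shows "\<bar>u \<bullet> cross3 v w\<bar> / 6 \<le> vol (S \<inter> cone3 u v w)"
proof -
  define f where "f x = (x$1) *\<^sub>R u + (x$2) *\<^sub>R v + (x$3) *\<^sub>R w" for x :: "real^3"
  let ?T = "convex hull (insert 0 Basis) :: (real^3) set"
  have lin: "linear f"
    by (rule linearI) (simp_all add: f_def algebra_simps)
  have T: "compact ?T" by (intro finite_imp_compact_convex_hull) simp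
  have "vol ?T = measure lborel ?T"
    using T by (intro measure_completion) (auto dest: compact_imp_closed)
  then have "vol ?T = 1 / 6"
    using content_std_simplex[where 'a = "real^3"] by (simp add: fact_numeral)
  moreover have "vol (f ` ?T) = \<bar>det (matrix f)\<bar> * vol ?T"
    using T lin by (intro measure_lebesgue_linear_transformation)
      (auto intro: compact_imp_bounded dest: compact_imp_closed)
  moreover have "det (matrix f) = u \<bullet> cross3 v w"
    by (simp add: det_3 matrix_def f_def axis_def cross3_def inner_vec_def sum_3 algebra_simps)
  ultimately have "\<bar>u \<bullet> cross3 v w\<bar> / 6 = vol (f ` ?T)"
    by simp
  also have "f ` ?T \<subseteq> S \<inter> cone3 u v w"
  proof -
    have "f ` insert 0 Basis \<subseteq> S \<inter> cone3 u v w"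
    proof -
      have "f 0 = 0" by (simp add: f_def)
      moreover have "f (axis i 1) \<in> S" for i
        using uvw exhaust_3[of i] by (auto simp: f_def axis_def)
      ultimately have "f ` insert 0 Basis \<subseteq> S"
        using S(3) by (auto simp: Basis_vec_def)
      moreover have "f ` insert 0 Basis \<subseteq> cone3 u v w"
        using cone3I[of 0 0 0 u v w] by (auto simp: f_def Basis_vec_def axis_def intro!: cone3I)
      ultimately show ?thesis by blast
    qed
    then show ?thesis
      unfolding convex_hull_linear_image[OF lin]
      by (intro hull_minimal convex_Int S convex_cone3)
  qed
  then have "vol (f ` ?T) \<le> vol (S \<inter> cone3 u v w)"
  proof (rule measure_mono_fmeasurable)
    have "compact (f ` ?T)"
      using T lin by (intro compact_continuous_image linear_continuous_on linear_linear[THEN iffD2])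
    then show "f ` ?T \<in> sets lebesgue"
      by (intro fmeasurableD lmeasurable_compact)
    show "S \<inter> cone3 u v w \<in> lmeasurable"
      using S by (intro measurable_convex convex_Int convex_cone3 bounded_Int) auto
  qed
  finally show ?thesis .
qed

section \<open>The sum of two orthogonal spindles\<close>

lemma reflection_inner_orthogonal: "a \<bullet> b = 0 \<Longrightarrow> reflection a x \<bullet> b = x \<bullet> b"
  by (simp add: reflection_def inner_diff_left)

lemma reflection_spindle_plus_spindle:
  fixes a :: "'a::euclidean_space"
  assumes a: "a \<noteq> 0" and x: "x \<in> spindle d + spindle e"
  shows "reflection a x \<in> spindle (reflection a d) + spindle (reflection a e)"
proof -
  have f: "orthogonal_transformation (reflection a)"
    by (rule orthogonal_transformation_reflection[OF a])
  obtain y z where yz: "x = y + z" "y \<in> spindle d" "z \<in> spindle e"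
    using x by (auto elim: set_plus_elim)
  have "reflection a x = reflection a y + reflection a z"
    unfolding yz(1) by (rule linear_add[OF orthogonal_transformation_linear[OF f]])
  moreover have "reflection a y \<in> spindle (reflection a d)"
    "reflection a z \<in> spindle (reflection a e)"
    using yz orthogonal_image_spindle[OF f] by blast+
  ultimately show ?thesis by (simp add: set_plus_intro)
qed

lemma reflection_axis:
  "reflection (axis k 1) (axis j 1) = (if j = k then - axis k 1 else (axis j 1 :: real^'n))"
  by (simp add: reflection_def inner_axis_axis vec_eq_iff)

lemma reflection_axis_swap_left:
  "reflection (axis 1 1 - axis k 1) (axis 1 1) = (axis k 1 :: real^'n::{finite,one})"
proof (cases "k = 1")
  case False
  then show ?thesis
    by (simp add: reflection_def inner_diff_left inner_diff_right inner_axis_axis)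
qed (simp add: reflection_def)

text \<open>The reflections in the coordinate planes and the swap of the first two axes generate a
  group of order 16 with this fundamental domain.\<close>

lemma vol_spindle_plus_spindle_symmetry:
  defines "S \<equiv> spindle (axis 1 1) + spindle (axis 2 1) :: (real^3) set"
  shows "vol S = 16 * vol (S \<inter> {x. 0 \<le> x$3 \<and> 0 \<le> x$2 \<and> 0 \<le> x$1 \<and> x$2 \<le> x$1})"
proof -
  have S: "S \<in> lmeasurable"
    unfolding S_def by (intro lmeasurable_compact compact_set_plus compact_spindle)
  have cl: "closed {x :: real^3. 0 \<le> x \<bullet> b}" for b
    using closed_halfspace_ge[of 0 b] by (simp add: inner_commute)
  have Int: "T \<inter> {x. 0 \<le> x \<bullet> b} \<in> lmeasurable" if "T \<in> lmeasurable" for T and b :: "real^3"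
    using that cl by (auto intro: fmeasurable_Int_fmeasurable)
  have ax: "reflection (axis k 1) x \<in> S" if "x \<in> S" for k x
    using reflection_spindle_plus_spindle[of "axis k 1" x "axis 1 1" "axis 2 1"] that
    by (auto simp: S_def reflection_axis spindle_minus axis_eq_0_iff split: if_splits)
  let ?a = "axis 1 1 - axis 2 1 :: real^3"
  have a0: "?a \<noteq> 0" by (simp add: axis_eq_axis)
  have sw: "reflection ?a x \<in> S" if "x \<in> S" for x
    using reflection_spindle_plus_spindle[OF a0, of x "axis 1 1" "axis 2 1"] that
    by (simp add: S_def reflection_axis_swap_right reflection_axis_swap_left add.commute)
  \<comment> \<open>Orthogonal normals keep the earlier half-spaces invariant under later
    reflections; the swap exchanges the conditions on the first two coordinates.\<close>
  have orth: "axis 3 1 \<bullet> (axis 2 1 :: real^3) = 0" "axis 2 1 \<bullet> (axis 3 1 :: real^3) = 0"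
    "axis 1 1 \<bullet> (axis 3 1 :: real^3) = 0"
     "axis 1 1 \<bullet> (axis 2 1 :: real^3) = 0" "?a \<bullet> axis 3 1 = 0"
    by (simp_all add: inner_diff_left inner_axis_axis)
  have "?a \<bullet> ?a = 2"
    by (simp add: inner_diff_left inner_diff_right inner_axis_axis)
  then have "reflection ?a x = x - (x \<bullet> ?a) *\<^sub>R ?a" for x
    by (simp add: reflection_def)
  then have a_in: "reflection ?a x \<bullet> axis 1 1 = x \<bullet> axis 2 1"
    "reflection ?a x \<bullet> axis 2 1 = x \<bullet> axis 1 1" for x
    by (simp_all add: inner_diff_left inner_diff_right inner_axis_axis)
  let ?T1 = "S \<inter> {x. 0 \<le> x \<bullet> axis 3 1}"
  let ?T2 = "?T1 \<inter> {x. 0 \<le> x \<bullet> axis 2 1}"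
  let ?T3 = "?T2 \<inter> {x. 0 \<le> x \<bullet> axis 1 1}"
  let ?T4 = "?T3 \<inter> {x. 0 \<le> x \<bullet> ?a}"
  have "vol S = 2 * vol ?T1"
    using S by (rule measure_reflection_halves) (simp_all add: ax axis_eq_0_iff)
  moreover have "vol ?T1 = 2 * vol ?T2"
    by (rule measure_reflection_halves) (simp_all add: S Int ax axis_eq_0_iff
      reflection_inner_orthogonal orth)
  moreover have "vol ?T2 = 2 * vol ?T3"
    by (rule measure_reflection_halves) (simp_all add: S Int ax axis_eq_0_iff
      reflection_inner_orthogonal orth)
  moreover have "vol ?T3 = 2 * vol ?T4"
    by (rule measure_reflection_halves) (simp_all add: S Int sw a0 a_in
      reflection_inner_orthogonal orth axis_eq_axis)
  moreover have "?T4 = S \<inter> {x. 0 \<le> x$3 \<and> 0 \<le> x$2 \<and> 0 \<le> x$1 \<and> x$2 \<le> x$1}"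
    by (auto simp: inner_axis inner_diff_right)
  ultimately show ?thesis by simp
qed

lemma vector3_simps:
  "vector [a, b, c] + vector [a', b', c'] = (vector [a + a', b + b', c + c'] :: real^3)"
  "t *\<^sub>R vector [a, b, c] = (vector [t * a, t * b, t * c] :: real^3)"
  "(axis 1 1 :: real^3) = vector [1, 0, 0]" "(axis 2 1 :: real^3) = vector [0, 1, 0]"
  "vector [a, b, c] = (vector [a', b', c'] :: real^3) \<longleftrightarrow> a = a' \<and> b = b' \<and> c = c'"
  "norm (vector [a, b, c] :: real^3) = sqrt (a\<^sup>2 + b\<^sup>2 + c\<^sup>2)"
  by (auto simp: vec_eq_iff forall_3 axis_def norm_vec_def L2_set_def sum_3)

text \<open>The fundamental domain is the cone over \<open>a\<close>, \<open>p\<close>,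
  \<open>v\<close>. Eleven splits cut it into twelve cones, each bounded below by an inscribed
  tetrahedron.\<close>

lemma vol_spindle_plus_spindle_gt:
  "800 * pi / 27 < vol (spindle (axis 1 1) + spindle (axis 2 1))"
proof -
  let ?S = "spindle (axis 1 1) + spindle (axis 2 1) :: (real^3) set"
  let ?M = "\<lambda>u v w. vol (?S \<inter> cone3 u v w)"
  have conv: "convex ?S" by (intro convex_set_plus convex_spindle)
  have bdd: "bounded ?S"
    by (intro compact_imp_bounded compact_set_plus compact_spindle)
  have ball: "u \<in> spindle e" if "norm u \<le> 1" for u e :: "real^3"
    unfolding spindle_def using that by (intro hull_inc) simp
  have apex: "3 *\<^sub>R e \<in> spindle e" for e :: "real^3"
    unfolding spindle_def by (intro hull_inc) simp
  have two: "2 *\<^sub>R u \<in> ?S" if "norm u \<le> 1" for u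
    using set_plus_intro[OF ball[OF that] ball[OF that]] by (simp add: scaleR_2)
  have three: "3 *\<^sub>R axis 1 1 + u \<in> ?S" if "norm u \<le> 1" for u
    by (intro set_plus_intro apex ball that)
  have zero: "0 \<in> ?S" using two[of 0] by simp
  note split = measure_Int_cone3_split[OF conv bdd]
  note leaf = det_le_measure_Int_cone3[OF conv bdd zero]
  txt \<open>
    The boundary of the sum consists of patches of the spheres \<open>2u\<close> and \<open>3e\<^sub>1 + u\<close>, ruled
    pieces joining them, and the flat face spanned by \<open>2u\<close>, \<open>3e\<^sub>1 + u\<close>, \<open>3e\<^sub>2 + u\<close>,
    \<open>3e\<^sub>1 + 3e\<^sub>2\<close> for \<open>u = (1/3, 1/3, sqrt 7 / 3)\<close>. The points below are its corners and a few
    sphere points, rounded inwards using \<open>82/93 < sqrt 7 / 3\<close> and \<open>82/87 < 2 * sqrt 2 / 3\<close>.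
    The points \<open>d\<close>, \<open>f\<close> and \<open>m\<close> are chosen in the planes through the origin spanned by
    \<open>v, e\<close>, by \<open>v, k\<close> and by \<open>b, v\<close>, so that repeatedly splitting a cone at a point of
    one of its edges produces exactly the cones over the faces of the inscribed polyhedron.
\<close>
  define p v a b c d e f k m q :: "real^3"
    where "p = vector [4, 0, 0]"
      and "v = vector [3, 3, 0]"
      and "a = vector [0, 0, 2]"
      and "b = vector [2/3, 0, 164/87]"
      and "c = vector [2/3, 2/3, 164/93]"
      and "d = vector [1674/511, 0, 492/511]"
      and "e = vector [10/3, 1/3, 82/93]"
      and "f = vector [125/34, 0, 25/34]"
      and "k = vector [11/3, 1/3, 2/3]"
      and "m = vector [90/77, 93/154, 123/77]"
      and "q = vector [343/87, 1/3, 0]"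
  note defs = p_def v_def a_def b_def c_def d_def e_def f_def k_def m_def q_def
  have aS: "a \<in> ?S"
    using two[of "vector [0, 0, 1]"] by (simp add: defs vector3_simps power2_eq_square)
  have bS: "b \<in> ?S"
    using two[of "vector [1/3, 0, 82/87]"] by (simp add: defs vector3_simps power2_eq_square)
  have cS: "c \<in> ?S"
    using two[of "vector [1/3, 1/3, 82/93]"] by (simp add: defs vector3_simps power2_eq_square)
  have eS: "e \<in> ?S"
    using three[of "vector [1/3, 1/3, 82/93]"] by (simp add: defs vector3_simps power2_eq_square)
  have fS: "f \<in> ?S"
    using three[of "vector [23/34, 0, 25/34]"] by (simp add: defs vector3_simps power2_eq_square)
  have kS: "k \<in> ?S"
    using three[of "vector [2/3, 1/3, 2/3]"] by (simp add: defs vector3_simps power2_eq_square)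
  have pS: "p \<in> ?S"
    using three[of "vector [1, 0, 0]"] by (simp add: defs vector3_simps power2_eq_square)
  have qS: "q \<in> ?S"
    using three[of "vector [82/87, 1/3, 0]"] by (simp add: defs vector3_simps power2_eq_square)
  have vS: "v \<in> ?S"
    using set_plus_intro[OF apex[of "axis 1 1"] apex[of "axis 2 1"]]
      by (simp add: defs vector3_simps)
  \<comment> \<open>\<open>d\<close> lies on the segment from \<open>2u\<close> to
    \<open>3e_1 + u\<close> for \<open>u = (1/3, 0, 82/87)\<close>; the weights put it in the plane
    of \<open>v\<close> and \<open>e\<close>.\<close>
  have "(11/511) *\<^sub>R b + (500/511) *\<^sub>R (vector [10/3, 0, 82/87]) \<in> ?S"
    using three[of "vector [1/3, 0, 82/87]"] bS
    by (intro convexD[OF conv]) (simp_all add: vector3_simps power2_eq_square)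
  then have dS: "d \<in> ?S"
    by (simp add: defs vector3_simps)
  \<comment> \<open>The same kind of segment for \<open>u = (1/3, 1/3, 82/93)\<close>; the weights
    put \<open>m\<close> in the plane of \<open>b\<close> and \<open>v\<close>.\<close>
  have "(125/154) *\<^sub>R c + (29/154) *\<^sub>R e \<in> ?S"
    using cS eS by (intro convexD[OF conv]) simp_all
  then have mS: "m \<in> ?S"
    by (simp add: defs vector3_simps)
  \<comment> \<open>In these four-letter names the third letter is the inserted point, and \<alpha>,
    \<beta> are its coordinates in the first two: here \<open>b\<close> is 82/87 of \<open>a\<close>
    plus 1/6 of \<open>p\<close>.\<close>
  have apbv: "?M a b v + ?M b p v \<le> ?M a p v"
    by (rule split[where \<alpha> = "82/87" and \<beta> = "1/6"]) (simp_all add: defs vec_eq_iff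
      forall_3 cross3_def)
  have avcb: "?M a c b + ?M c v b \<le> ?M a v b"
    by (rule split[where \<alpha> = "82/93" and \<beta> = "2/9"]) (simp_all add: defs vec_eq_iff
      forall_3 cross3_def)
  have bpdv: "?M b d v + ?M d p v \<le> ?M b p v"
    by (rule split[where \<alpha> = "261/511" and \<beta> = "375/511"]) (simp_all add: defs vec_eq_iff
      forall_3 cross3_def)
  have dveb: "?M d e b + ?M e v b \<le> ?M d v b"
    by (rule split[where \<alpha> = "511/558" and \<beta> = "1/9"]) (simp_all add: defs vec_eq_iff
      forall_3 cross3_def)
  have bvmc: "?M b m c + ?M m v c \<le> ?M b v c"
    by (rule split[where \<alpha> = "261/308" and \<beta> = "31/154"]) (simp_all add: defs vec_eq_iff
      forall_3 cross3_def)
  have bvme: "?M b m e + ?M m v e \<le> ?M b v e"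
    by (rule split[where \<alpha> = "261/308" and \<beta> = "31/154"]) (simp_all add: defs vec_eq_iff
      forall_3 cross3_def)
  have dpfv: "?M d f v + ?M f p v \<le> ?M d p v"
    by (rule split[where \<alpha> = "12775/16728" and \<beta> = "3275/11152"]) (simp_all add: defs vec_eq_iff
      forall_3 cross3_def)
  have dvef: "?M d e f + ?M e v f \<le> ?M d v f"
    by (rule split[where \<alpha> = "511/558" and \<beta> = "1/9"]) (simp_all add: defs vec_eq_iff
      forall_3 cross3_def)
  have fvke: "?M f k e + ?M k v e \<le> ?M f v e"
    by (rule split[where \<alpha> = "68/75" and \<beta> = "1/9"]) (simp_all add: defs vec_eq_iff
      forall_3 cross3_def)
  have fvkp: "?M f k p + ?M k v p \<le> ?M f v p"
    by (rule split[where \<alpha> = "68/75" and \<beta> = "1/9"]) (simp_all add: defs vec_eq_iff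
      forall_3 cross3_def)
  have pvqk: "?M p q k + ?M q v k \<le> ?M p v k"
    by (rule split[where \<alpha> = "157/174" and \<beta> = "1/9"]) (simp_all add: defs vec_eq_iff
      forall_3 cross3_def)
  \<comment> \<open>The twelve constants are exact tetrahedron volumes, one sixth of the absolute
    determinant.\<close>
  have abc: "4/27 \<le> ?M a b c"
    using leaf[OF aS bS cS] by (simp add: defs cross3_def inner_vec_def sum_3)
  have bde: "41000/133371 \<le> ?M b d e"
    using leaf[OF bS dS eS] by (simp add: defs cross3_def inner_vec_def sum_3)
  have bcm: "82/693 \<le> ?M b c m"
    using leaf[OF bS cS mS] by (simp add: defs cross3_def inner_vec_def sum_3)
  have cmv: "1189/2387 \<le> ?M c m v"
    using leaf[OF cS mS vS] by (simp add: defs cross3_def inner_vec_def sum_3)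
  have bem: "10250/20097 \<le> ?M b e m"
    using leaf[OF bS eS mS] by (simp add: defs cross3_def inner_vec_def sum_3)
  have emv: "5125/2387 \<le> ?M e m v"
    using leaf[OF eS mS vS] by (simp add: defs cross3_def inner_vec_def sum_3)
  have deff: "3275/52122 \<le> ?M d e f"
    using leaf[OF dS eS fS] by (simp add: defs cross3_def inner_vec_def sum_3)
  have ekv: "131/279 \<le> ?M e k v"
    using leaf[OF eS kS vS] by (simp add: defs cross3_def inner_vec_def sum_3)
  have efk: "3275/56916 \<le> ?M e f k"
    using leaf[OF eS fS kS] by (simp add: defs cross3_def inner_vec_def sum_3)
  have fkp: "25/153 \<le> ?M f k p"
    using leaf[OF fS kS pS] by (simp add: defs cross3_def inner_vec_def sum_3)
  have kqv: "314/261 \<le> ?M k q v"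
    using leaf[OF kS qS vS] by (simp add: defs cross3_def inner_vec_def sum_3)
  have kpq: "4/27 \<le> ?M k p q"
    using leaf[OF kS pS qS] by (simp add: defs cross3_def inner_vec_def sum_3)
  have "?S \<inter> cone3 a p v \<subseteq> ?S \<inter> {x. 0 \<le> x$3 \<and> 0 \<le> x$2 \<and> 0 \<le> x$1 \<and> x$2 \<le> x$1}"
    by (auto simp: cone3_def defs)
  then have "?M a p v \<le> vol (?S \<inter> {x. 0 \<le> x$3 \<and> 0 \<le> x$2 \<and> 0 \<le> x$1 \<and> x$2 \<le> x$1})"
  proof (rule measure_mono_fmeasurable)
    show "?S \<inter> cone3 a p v \<in> sets lebesgue"
      using conv bdd by (intro fmeasurableD measurable_convex convex_Int convex_cone3 bounded_Int)
        auto
    have "{x :: real^3. 0 \<le> x$3 \<and> 0 \<le> x$2 \<and> 0 \<le> x$1 \<and> x$2 \<le> x$1} \<in> sets borel"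
      by measurable
    then show "?S \<inter> {x. 0 \<le> x$3 \<and> 0 \<le> x$2 \<and> 0 \<le> x$1 \<and> x$2 \<le> x$1} \<in> lmeasurable"
      using measurable_convex[OF conv bdd] by (intro fmeasurable_Int_fmeasurable) auto
  qed
  \<comment> \<open>With generators sorted alphabetically, a cone reached from different splits
    becomes one and the same term of the linear sum.\<close>
  moreover have perms: "cone3 a c b = cone3 a b c"
      "cone3 a v b = cone3 a b v"
      "cone3 b m c = cone3 b c m"
      "cone3 b m e = cone3 b e m"
      "cone3 b v c = cone3 b c v"
      "cone3 b v e = cone3 b e v"
      "cone3 c v b = cone3 b c v"
      "cone3 d e b = cone3 b d e"
      "cone3 d v b = cone3 b d v"
      "cone3 d v f = cone3 d f v"
      "cone3 e v b = cone3 b e v"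
      "cone3 e v f = cone3 e f v"
      "cone3 f k e = cone3 e f k"
      "cone3 f v e = cone3 e f v"
      "cone3 f v p = cone3 f p v"
      "cone3 k v e = cone3 e k v"
      "cone3 k v p = cone3 k p v"
      "cone3 m v c = cone3 c m v"
      "cone3 m v e = cone3 e m v"
      "cone3 p q k = cone3 k p q"
      "cone3 p v k = cone3 k p v"
      "cone3 q v k = cone3 k q v"
    using cone3_swap by metis+
  \<comment> \<open>This is only slightly above 35/6; sixteen copies of 35/6 make 280/3, which the
    bound on pi places above the target.\<close>
  moreover have "1640092409 / 46857678 / 6 \<le> ?M a p v"
    using apbv avcb bpdv dveb bvmc bvme dpfv dvef fvke fvkp pvqk abc bde bcm cmv bem emv deff ekv
      efk fkp kqv kpq
    unfolding perms by linarith
  ultimately show ?thesis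
    using pi_less_63_20 vol_spindle_plus_spindle_symmetry by simp
qed

section \<open>From the volume bound to the two claims\<close>

lemma vol_scaleR_image:
  fixes S :: "(real^3) set"
  assumes "S \<in> lmeasurable" "0 \<le> t"
  shows "vol ((*\<^sub>R) t ` S) = t^3 * vol S"
  using measure_linear_image[OF linear_scaleR assms(1), of t] assms(2)
  by (simp add: det_matrix_scaleR)

theorem proposition10:
  fixes K1 K2 :: "(real^3) set"
  assumes K1: "K1 = convex hull (unit_ball \<union> {- 3 *\<^sub>R axis 1 1, 3 *\<^sub>R axis 1 1})"
    and K2: "K2 = convex hull (unit_ball \<union> {- 3 *\<^sub>R axis 2 1, 3 *\<^sub>R axis 2 1})"
  shows "Q3 K1 K2 < 1 \<and>
    (\<forall>\<^sub>F t :: real in at_top.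
       let B = (*\<^sub>R) t ` K1; C = (*\<^sub>R) t ` K2
       in \<not> root 3 (vol B * vol C) + root 3 (vol unit_ball * vol (unit_ball + B + C))
            \<le> root 3 (vol (unit_ball + B)) * root 3 (vol (unit_ball + C)))"
proof
  have K: "K1 = spindle (axis 1 1)" "K2 = spindle (axis 2 1)"
    by (simp_all add: K1 K2 spindle_def)
  define V where "V = vol (K1 + K2)"
  define \<alpha> \<beta> where "\<alpha> = 20 * pi / 9" and "\<beta> = 4 * pi / 3"
  have pos: "0 < \<alpha>" "0 < \<beta>" by (simp_all add: \<alpha>_def \<beta>_def)
  have V: "800 * pi / 27 < V"
    using vol_spindle_plus_spindle_gt by (simp add: V_def K)
  have "0 < V"
    by (rule less_trans[OF _ V]) simp
  \<comment> \<open>Both spindles have surface area three times their volume, so \<open>Q3\<close>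
    reduces to \<open>8 * \<alpha>\<^sup>2 / (\<beta> * V)\<close>; 800 pi / 27 is the value of
    \<open>V\<close> at which this equals 1.\<close>
  have "\<beta> * (800 * pi / 27) = 8 * \<alpha>\<^sup>2"
    by (simp add: \<alpha>_def \<beta>_def power2_eq_square)
  then have gap: "8 * \<alpha>\<^sup>2 < \<beta> * V"
    using mult_strict_left_mono[OF V pos(2)] by (simp only:)
  have "Q3 K1 K2 = 8 * \<alpha>\<^sup>2 / (\<beta> * V)"
    unfolding Q3_def K surface_area_spindle vol_spindle vol_unit_ball V_def
    by (simp add: \<alpha>_def \<beta>_def power2_eq_square)
  then show "Q3 K1 K2 < 1"
    using gap pos \<open>0 < V\<close> by simp
  \<comment> \<open>Both sides have leading term \<open>p * t\<^sup>2\<close>; the coefficients of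
    \<open>t\<close> to compare are \<open>q\<close> on the left and \<open>2 * p\<close> on the
    right.\<close>
  define p q where "p = (root 3 \<alpha>)\<^sup>2" and "q = root 3 (\<beta> * V)"
  have "(2 * p)^3 = 8 * \<alpha>\<^sup>2"
  proof -
    have "(2 * p)^3 = 8 * ((root 3 \<alpha>)^3)\<^sup>2"
      by (simp add: p_def power_mult_distrib flip: power_mult)
    then show ?thesis using pos by simp
  qed
  then have "2 * p < q"
    using gap pos \<open>0 < V\<close> unfolding q_def
    by (intro power_less_imp_less_base[of "2 * p" 3]) simp_all
  show "\<forall>\<^sub>F t :: real in at_top.
       let B = (*\<^sub>R) t ` K1; C = (*\<^sub>R) t ` K2
       in \<not> root 3 (vol B * vol C) + root 3 (vol unit_ball * vol (unit_ball + B + C))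
            \<le> root 3 (vol (unit_ball + B)) * root 3 (vol (unit_ball + C))"
    \<comment> \<open>Past the second threshold the linear gain \<open>t * (q - 2 * p)\<close> beats
      the constant term of \<open>p * (t + 1)\<^sup>2\<close>.\<close>
    using eventually_gt_at_top[of 0] eventually_gt_at_top[of "p / (q - 2 * p)"]
  proof eventually_elim
    case (elim t)
    define X where "X = \<alpha> * (t^3 + 3 * t\<^sup>2 + 3 * t) + \<beta>"
    let ?B = "(*\<^sub>R) t ` K1" and ?C = "(*\<^sub>R) t ` K2"
    have vB: "vol ((*\<^sub>R) t ` spindle (axis k 1)) = \<alpha> * t^3" for k
      using vol_scaleR_image[of "spindle (axis k 1)" t] elim
      by (simp add: lmeasurable_compact compact_spindle vol_spindle \<alpha>_def)
    have vX: "vol (unit_ball + (*\<^sub>R) t ` spindle (axis k 1)) = X" for k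
      using vol_spindle_plus_ball[of t 1 k] elim by (simp add: add.commute X_def \<alpha>_def \<beta>_def)
    have "root 3 (vol ?B * vol ?C) = root 3 (\<alpha> * t^3) * root 3 (\<alpha> * t^3)"
      by (simp add: K vB real_root_mult)
    also have "\<dots> = t\<^sup>2 * p"
      using elim by (simp add: real_root_mult real_root_power_cancel p_def power2_eq_square)
    finally have 1: "root 3 (vol ?B * vol ?C) = t\<^sup>2 * p" .
    \<comment> \<open>Here \<open>X = \<alpha> * ((t + 1)^3 - 1) + \<beta>\<close> with
      \<open>\<beta> \<le> \<alpha>\<close>.\<close>
    have "X \<le> \<alpha> * (t + 1)^3"
    proof -
      have "\<beta> \<le> \<alpha>" by (simp add: \<alpha>_def \<beta>_def)
      then show ?thesis by (simp add: X_def power2_eq_square power3_eq_cube algebra_simps)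
    qed
    then have "root 3 X \<le> root 3 \<alpha> * (t + 1)"
      using elim real_root_le_mono[of 3 X "\<alpha> * (t + 1)^3"]
      by (simp add: real_root_mult real_root_power_cancel)
    moreover have "0 \<le> root 3 X"
      using elim pos by (simp add: X_def)
    ultimately have "root 3 X * root 3 X \<le> (root 3 \<alpha> * (t + 1)) * (root 3 \<alpha> * (t + 1))"
      using elim pos by (intro mult_mono) auto
    also have "\<dots> = p * (t + 1)\<^sup>2"
      by (simp add: p_def power2_eq_square)
    finally have 2: "root 3 (vol (unit_ball + ?B)) * root 3 (vol (unit_ball + ?C)) \<le> p * (t + 1)\<^sup>2"
      by (simp add: K vX)
    have cB: "compact K1" "compact K2" by (simp_all add: K compact_spindle)
    \<comment> \<open>The origin lies in the unit ball, so the triple sum contains the dilate of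
      \<open>K1 + K2\<close>; this retains the leading cubic term.\<close>
    have "t^3 * V \<le> vol (unit_ball + ?B + ?C)"
    proof -
      have "(*\<^sub>R) t ` (K1 + K2) \<subseteq> unit_ball + ?B + ?C"
      proof
        fix x assume "x \<in> (*\<^sub>R) t ` (K1 + K2)"
        then obtain y z where "y \<in> K1" "z \<in> K2" "x = 0 + t *\<^sub>R y + t *\<^sub>R z"
          by (auto elim!: set_plus_elim simp: scaleR_add_right)
        then show "x \<in> unit_ball + ?B + ?C"
          by (metis centre_in_cball image_eqI set_plus_intro zero_le_one)
      qed
      then have "vol ((*\<^sub>R) t ` (K1 + K2)) \<le> vol (unit_ball + ?B + ?C)"
        using cB by (intro measure_mono_fmeasurable fmeasurableD lmeasurable_compact
            compact_scaling compact_set_plus compact_cball)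
      then show ?thesis
        using elim cB by (simp add: V_def vol_scaleR_image lmeasurable_compact compact_set_plus)
    qed
    then have "root 3 (\<beta> * (t^3 * V)) \<le> root 3 (vol unit_ball * vol (unit_ball + ?B + ?C))"
      using pos by (intro real_root_le_mono) (simp_all add: vol_unit_ball \<beta>_def mult.commute)
    moreover have "root 3 (\<beta> * (t^3 * V)) = t * q"
      using elim by (simp add: real_root_mult real_root_power_cancel q_def)
    ultimately have 3: "t * q \<le> root 3 (vol unit_ball * vol (unit_ball + ?B + ?C))" by simp
    have "p < t * (q - 2 * p)"
      using elim(2) \<open>2 * p < q\<close> by (simp add: pos_divide_less_eq)
    then have "p * (t + 1)\<^sup>2 < t\<^sup>2 * p + t * q"
      by (simp add: power2_eq_square algebra_simps)
    then show ?case using 1 2 3 by (simp add: Let_def)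
  qed
qed

end
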